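(* Let $N\ge1$, let $p\ge1$ be an integer, let $E\subset\mathfrak{LC}_p(\mathbb R^{2N},\mathbb R^N)$ have $L^1_{loc}$-equicontinuous $m$-bounds, and let $\Theta=\{\theta^I_j\}$ be the suitable set of moduli of continuity given by the $m$-bounds of $E$, i.e. $\theta^I_j(s)=\sup_{t\in I,\,f\in E}\int_t^{t+s}m^j_f(u)\,du$. Let $D$ be any countable dense subset of $\mathbb R^N$ and $\mathcal C=C([-1,0],\mathbb R^N)$. Then: (i) If $(f_n)_{n\in\mathbb N}$ is a sequence in $E$ converging to $f$ in $(\mathfrak{LC}_p(\mathbb R^{2N},\mathbb R^N),\mathcal T_{\Theta B})$ and $(\phi_n)_{n\in\mathbb N}$ is a sequence in $\mathcal C$ converging uniformly to $\phi\in\mathcal C$, then $$x(\cdot,f_n,\phi_n)\xrightarrow{n\to\infty}x(\cdot,f,\phi)$$ uniformly in any $[-1,T]\subset I_{f,\phi}$. (ii) If $E$ has also $L^1_{loc}$-bounded $l_2$-bounds, $(f_n)_{n\in\mathbb N}$ is a sequence in $E$ converging to $f$ in $(\mathfrak{LC}(\mathbb R^{2N},\mathbb R^N),\sigma_{\Theta D})$ and $(\phi_n)_{n\in\mathbb N}$ is a sequence in $\mathcal C$ converging uniformly to $\phi\in\mathcal C$, then $$x(\cdot,f_n,\phi_n)\xrightarrow{n\to\infty}x(\cdot,f,\phi)$$ uniformly in any $[-1,T]\subset I_{f,\phi}$.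
   Context: $B_j$ is the closed ball of radius $j$ centered at the origin; $C(I,W)$ is the space of continuous functions $I\to W$. $L^p_{loc}$ is the set of real functions on $\mathbb R$ belonging to $L^p(I)$ for every compact interval $I$. $\mathfrak{LC}_p(\mathbb R^{2N},\mathbb R^N)$ is the set of functions $f:\mathbb R\times\mathbb R^{2N}\to\mathbb R^N$ such that: $f$ is Borel measurable; for every compact $K\subset\mathbb R^{2N}$ there are $m^K,l^K\in L^p_{loc}$ such that for a.e. $t\in\mathbb R$, $|f(t,z)|\le m^K(t)$ and $|f(t,z_1)-f(t,z_2)|\le l^K(t)|z_1-z_2|$ for all $z,z_1,z_2\in K$. Functions differing only on a negligible set are identified. $\mathfrak{LC}=\mathfrak{LC}_1$. Points of $\mathbb R^{2N}$ are written $(x,u)$. Optimal bounds of $f$ on $B_j\subset\mathbb R^{2N}$: $m^j_f(t)=\sup_{z\in B_j}|f(t,z)|$ and $l^j_{2,f}(t)=\sup|f(t,x,u_1)-f(t,x,u_2)|/|u_1-u_2|$ over $(x,u_1),(x,u_2)\in B_j$, $u_1\ne u_2$. $E$ has $L^1_{loc}$-equicontinuous $m$-bounds if for every $j\in\mathbb N$, $r,\varepsilon>0$ there is $\delta>0$ with $\sup_{f\in E}\int_s^t m^j_f(u)\,du<\varepsilon$ whenever $-r\le s\le t\le r$, $t-s<\delta$. $E$ has $L^1_{loc}$-bounded $l_2$-bounds if $\sup_{f\in E}\int_{-r}^r l^j_{2,f}(t)\,dt<\infty$ for every $j\in\mathbb N$, $r>0$. A suitable set of moduli of continuity is a countable set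 $\{\theta^I_j: j\in\mathbb N,\ I=[q_1,q_2],\ q_1,q_2\in\mathbb Q\}$ of non-decreasing continuous functions $[0,\infty)\to[0,\infty)$ with $\theta^I_j(0)=0$ and $\theta^{I_1}_{j_1}\le\theta^{I_2}_{j_2}$ whenever $I_1\subseteq I_2$, $j_1\le j_2$. $\mathcal K^I_j$ is the set of $x\in C(I,B_j)$, $B_j\subset\mathbb R^N$, with $|x(t)-x(s)|\le\theta^I_j(|t-s|)$ for all $t,s\in I$. Topologies, generated by the following seminorms over all $I=[q_1,q_2]$, $q_1,q_2\in\mathbb Q$, $j\in\mathbb N$ ($I-1$ is the translate of $I$): - $\mathcal T_{\Theta B}$: $\sup_{x\in\mathcal K^I_j,\,u\in C(I-1,B_j)}[\int_I|f(t,x(t),u(t-1))|^pdt]^{1/p}$; - $\sigma_{\Theta D}$: $\sup_{x\in\mathcal K^I_j}|\int_If(t,x(t),u)\,dt|$, $u\in D$. For $f\in\mathfrak{LC}(\mathbb R^{2N},\mathbb R^N)$ and $\phi\in\mathcal C$, $x(\cdot,f,\phi)$ denotes the unique maximal continuous (Carathéodory) solution, with maximal interval of definition $I_{f,\phi}=[-1,b_{f,\phi})$, of $\dot x=f(t,x(t),x(t-1))$ for $t>0$, $x(t)=\phi(t)$ for $t\in[-1,0]$; if $b_{f,\phi}<\infty$ then $|x(t,f,\phi)|\to\infty$ as $t\to b_{f,\phi}$. Convergence on $[-1,T]$ is understood for $n$ large enough that $[-1,T]\subset I_{f_n,\phi_n}$, this being part of the assertion. *)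

theory Defs
  imports "HOL-Analysis.Analysis"
begin

text \<open>A right-hand side \<open>f\<close> is evaluated as \<open>f t (x, u)\<close>, the point \<open>(x, u)\<close> of the Euclidean space
  \<open>(real ^ 'n) \<times> (real ^ 'n)\<close> standing for \<open>(x(t), x(t - 1))\<close>. We work with representatives:
  every notion below is insensitive to changing \<open>f t\<close> for \<open>t\<close> in a negligible set.\<close>

type_synonym 'n delay_rhs = "real \<Rightarrow> (real ^ 'n) \<times> (real ^ 'n) \<Rightarrow> real ^ 'n"


subsection \<open>Lipschitz Caratheodory functions\<close>

definition Lp_loc :: "nat \<Rightarrow> (real \<Rightarrow> real) set" where
  "Lp_loc p = {m. m \<in> borel_measurable lebesgue \<and>
     (\<forall>a b. set_integrable lebesgue {a..b} (\<lambda>t. \<bar>m t\<bar> ^ p))}"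

definition LC :: "nat \<Rightarrow> ('n::finite) delay_rhs set" where
  "LC p = {f. (\<lambda>(t, z). f t z) \<in> borel_measurable borel \<and>
     (\<forall>K. compact K \<longrightarrow> (\<exists>m \<in> Lp_loc p. \<exists>l \<in> Lp_loc p. AE t in lebesgue.
        (\<forall>z \<in> K. norm (f t z) \<le> m t) \<and>
        (\<forall>z1 \<in> K. \<forall>z2 \<in> K. norm (f t z1 - f t z2) \<le> l t * norm (z1 - z2))))}"


subsection \<open>Optimal bounds\<close>

text \<open>The suprema are taken in \<open>[0, \<infinity>]\<close>, since they may be infinite for \<open>t\<close> in a negligible set.\<close>

definition m_bound :: "('n::finite) delay_rhs \<Rightarrow> nat \<Rightarrow> real \<Rightarrow> ennreal" where
  "m_bound f j t = (SUP z \<in> cball 0 (real j). ennreal (norm (f t z)))"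

definition l2_bound :: "('n::finite) delay_rhs \<Rightarrow> nat \<Rightarrow> real \<Rightarrow> ennreal" where
  "l2_bound f j t =
     (SUP (x, u1, u2) \<in> {(x, u1, u2). (x, u1) \<in> cball 0 (real j) \<and> (x, u2) \<in> cball 0 (real j) \<and> u1 \<noteq> u2}.
        ennreal (norm (f t (x, u1) - f t (x, u2)) / norm (u1 - u2)))"

definition L1loc_equicontinuous_m_bounds :: "('n::finite) delay_rhs set \<Rightarrow> bool" where
  "L1loc_equicontinuous_m_bounds E \<longleftrightarrow>
     (\<forall>j. \<forall>r>0. \<forall>\<epsilon>>0. \<exists>\<delta>>0. \<forall>s t. - r \<le> s \<and> s \<le> t \<and> t \<le> r \<and> t - s < \<delta> \<longrightarrow>
        (SUP f \<in> E. \<integral>\<^sup>+\<tau>\<in>{s..t}. m_bound f j \<tau> \<partial>lebesgue) < ennreal \<epsilon>)"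

definition L1loc_bounded_l2_bounds :: "('n::finite) delay_rhs set \<Rightarrow> bool" where
  "L1loc_bounded_l2_bounds E \<longleftrightarrow>
     (\<forall>j. \<forall>r>0. (SUP f \<in> E. \<integral>\<^sup>+t\<in>{-r..r}. l2_bound f j t \<partial>lebesgue) < \<infinity>)"


subsection \<open>Moduli of continuity and topologies\<close>

text \<open>A family of moduli \<open>\<theta>\<close> is applied as \<open>\<theta> q1 q2 j s\<close>, for the interval \<open>I = [q1, q2]\<close>.\<close>

type_synonym moduli = "real \<Rightarrow> real \<Rightarrow> nat \<Rightarrow> real \<Rightarrow> real"

text \<open>The supremum below is finite when \<open>E\<close> has equicontinuous m-bounds, so \<open>enn2real\<close> loses nothing.\<close>

definition m_bounds_moduli :: "('n::finite) delay_rhs set \<Rightarrow> moduli" where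
  "m_bounds_moduli E q1 q2 j s =
     enn2real (SUP (t, f) \<in> {q1..q2} \<times> E. \<integral>\<^sup>+\<tau>\<in>{t..t + s}. m_bound f j \<tau> \<partial>lebesgue)"

definition C_ball :: "real \<Rightarrow> real \<Rightarrow> nat \<Rightarrow> (real \<Rightarrow> real ^ 'n::finite) set" where
  "C_ball a b j = {x. continuous_on {a..b} x \<and> x ` {a..b} \<subseteq> cball 0 (real j)}"

definition K_set :: "moduli \<Rightarrow> real \<Rightarrow> real \<Rightarrow> nat \<Rightarrow> (real \<Rightarrow> real ^ 'n::finite) set" where
  "K_set \<theta> q1 q2 j = {x \<in> C_ball q1 q2 j.
     \<forall>t \<in> {q1..q2}. \<forall>s \<in> {q1..q2}. norm (x t - x s) \<le> \<theta> q1 q2 j \<bar>t - s\<bar>}"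

definition seminorm_ThetaB ::
    "nat \<Rightarrow> moduli \<Rightarrow> real \<Rightarrow> real \<Rightarrow> nat \<Rightarrow> ('n::finite) delay_rhs \<Rightarrow> real" where
  "seminorm_ThetaB p \<theta> q1 q2 j f =
     (SUP (x, u) \<in> K_set \<theta> q1 q2 j \<times> C_ball (q1 - 1) (q2 - 1) j.
        root p (LINT t:{q1..q2}|lebesgue. norm (f t (x t, u (t - 1))) ^ p))"

definition seminorm_ThetaD ::
    "moduli \<Rightarrow> real \<Rightarrow> real \<Rightarrow> nat \<Rightarrow> real ^ 'n \<Rightarrow> ('n::finite) delay_rhs \<Rightarrow> real" where
  "seminorm_ThetaD \<theta> q1 q2 j u f =
     (SUP x \<in> K_set \<theta> q1 q2 j. norm (LINT t:{q1..q2}|lebesgue. f t (x t, u)))"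

definition seminorm_topology :: "'a::minus set \<Rightarrow> ('a \<Rightarrow> real) set \<Rightarrow> 'a topology" where
  "seminorm_topology X S =
     topology_generated_by {{g \<in> X. s (g - f) < \<epsilon>} | f s \<epsilon>. f \<in> X \<and> s \<in> S \<and> 0 < \<epsilon>}"

definition T_ThetaB :: "nat \<Rightarrow> moduli \<Rightarrow> ('n::finite) delay_rhs topology" where
  "T_ThetaB p \<theta> = seminorm_topology (LC p)
     {seminorm_ThetaB p \<theta> q1 q2 j | q1 q2 j. q1 \<in> \<rat> \<and> q2 \<in> \<rat> \<and> q1 \<le> q2}"

definition sigma_ThetaD :: "moduli \<Rightarrow> (real ^ 'n) set \<Rightarrow> ('n::finite) delay_rhs topology" where
  "sigma_ThetaD \<theta> D = seminorm_topology (LC 1)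
     {seminorm_ThetaD \<theta> q1 q2 j u | q1 q2 j u. q1 \<in> \<rat> \<and> q2 \<in> \<rat> \<and> q1 \<le> q2 \<and> u \<in> D}"


subsection \<open>Solutions of the delay equation\<close>

text \<open>\<open>x\<close> solves \<open>x'(t) = f(t, x(t), x(t - 1))\<close> on \<open>[-1, b)\<close>, with initial function \<open>\<phi>\<close> on \<open>[-1, 0]\<close>,
  in the sense of Caratheodory, that is, in integrated form. The values of \<open>x\<close> outside
  \<open>[-1, b)\<close> are irrelevant.\<close>

definition caratheodory_solution ::
    "('n::finite) delay_rhs \<Rightarrow> (real \<Rightarrow> real ^ 'n) \<Rightarrow> ereal \<Rightarrow> (real \<Rightarrow> real ^ 'n) \<Rightarrow> bool" where
  "caratheodory_solution f \<phi> b x \<longleftrightarrow>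
     0 < b \<and>
     continuous_on {t. -1 \<le> t \<and> ereal t < b} x \<and>
     (\<forall>t \<in> {-1..0}. x t = \<phi> t) \<and>
     (\<forall>t. 0 \<le> t \<and> ereal t < b \<longrightarrow>
        set_integrable lebesgue {0..t} (\<lambda>s. f s (x s, x (s - 1))) \<and>
        x t = \<phi> 0 + (LINT s:{0..t}|lebesgue. f s (x s, x (s - 1))))"

definition maximal_solution ::
    "('n::finite) delay_rhs \<Rightarrow> (real \<Rightarrow> real ^ 'n) \<Rightarrow> ereal \<Rightarrow> (real \<Rightarrow> real ^ 'n) \<Rightarrow> bool" where
  "maximal_solution f \<phi> b x \<longleftrightarrow>
     caratheodory_solution f \<phi> b x \<and>
     (\<forall>b' y. caratheodory_solution f \<phi> b' y \<and> (\<forall>t. -1 \<le> t \<and> ereal t < b \<longrightarrow> y t = x t) \<longrightarrow> b' \<le> b)"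

text \<open>For \<open>f \<in> LC p\<close> and \<open>\<phi>\<close> continuous on \<open>[-1, 0]\<close> there is a maximal solution, and its interval
  \<open>[-1, sol_end f \<phi>)\<close> and its values there are uniquely determined.\<close>

definition sol_end :: "('n::finite) delay_rhs \<Rightarrow> (real \<Rightarrow> real ^ 'n) \<Rightarrow> ereal" where
  "sol_end f \<phi> = (THE b. \<exists>x. maximal_solution f \<phi> b x)"

definition sol :: "('n::finite) delay_rhs \<Rightarrow> (real \<Rightarrow> real ^ 'n) \<Rightarrow> real \<Rightarrow> real ^ 'n" where
  "sol f \<phi> = (SOME x. maximal_solution f \<phi> (sol_end f \<phi>) x)"

end

theory Submission
  imports Defs
begin

text \<open>Let \<open>x\<close> solve the limit equation on \<open>[-1, S]\<close> and \<open>y\<close> the \<open>n\<close>-th approximating one. On a step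
  \<open>[a, b]\<close> so short that the Lipschitz bound of \<open>f\<close> has small integral, \<open>\<parallel>y - x\<parallel>\<close> is at most twice its
  value on the past plus the integral of \<open>fs n - f\<close> along \<open>y\<close>. The latter tends to \<open>0\<close>: as long as \<open>y\<close>
  is bounded it has the modulus of continuity given by the m-bounds of \<open>E\<close>, so it belongs to the sets over
  which the seminorms take suprema. For \<open>\<T>\<^sub>\<Theta>\<^sub>B\<close> this is immediate. For \<open>\<sigma>\<^sub>\<Theta>\<^sub>D\<close>, a step of length at most
  \<open>1\<close> makes \<open>y(s - 1)\<close> already known to be close to the continuous function \<open>x(s - 1)\<close>, which is
  replaced by a step function on a rational grid with values in \<open>D\<close> at a cost controlled by the \<open>l\<^sub>2\<close>-bounds.
  Since \<open>y\<close> stays near \<open>x\<close> it cannot blow up within the step, and finitely many steps reach \<open>S\<close>.\<close>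

subsection \<open>Lipschitz Caratheodory functions along curves\<close>

text \<open>The limit \<open>f\<close> need not lie in \<open>E\<close>. The error is therefore
  split into \<open>fs n - f\<close> along \<open>y\<close> and the increment of \<open>f\<close>
  between \<open>y\<close> and \<open>x\<close>: the feedback then involves only the fixed Lipschitz
  bound of \<open>f\<close>, whereas \<open>E\<close> offers no uniform Lipschitz bound in the first
  variable. The second obstacle is the order of choices. A seminorm belongs to a rational interval
  and to curves defined on all of it, and it must be chosen before \<open>n\<close>; the
  approximating solution is controlled only up to a time \<tau> that depends on \<open>n\<close> and
  may be irrational. With the norm under the integral, as in \<open>T_ThetaB\<close>, passing from
  \<open>{a..\<tau>}\<close> to \<open>{a..b}\<close> only increases the quantity. In
  \<open>sigma_ThetaD\<close> the norm stands outside, cancellation is possible and this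
  monotonicity fails. There the integral is cut at the last grid point before \<tau>; the rest,
  shorter than the mesh, is small by the equicontinuous m-bounds for \<open>fs n\<close> and by
  absolute continuity of the integral for \<open>f\<close>.\<close>

lemma Lp_loc_add:
  assumes "m1 \<in> Lp_loc p" "m2 \<in> Lp_loc p"
  shows "(\<lambda>t. \<bar>m1 t\<bar> + \<bar>m2 t\<bar>) \<in> Lp_loc p"
proof -
  have [measurable]: "m1 \<in> borel_measurable lebesgue" "m2 \<in> borel_measurable lebesgue"
    using assms by (auto simp: Lp_loc_def)
  have "set_integrable lebesgue {a..b} (\<lambda>t. \<bar>\<bar>m1 t\<bar> + \<bar>m2 t\<bar>\<bar> ^ p)" for a b
  proof (rule set_integrable_bound)
    show "set_integrable lebesgue {a..b} (\<lambda>t. 2 ^ p * (\<bar>m1 t\<bar> ^ p + \<bar>m2 t\<bar> ^ p))"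
      using assms by (auto simp: Lp_loc_def)
    \<comment> \<open>Both terms are replaced by the larger one; only finiteness of the integral
      matters, so the crude constant \<open>2 ^ p\<close> does no harm.\<close>
    have "(\<bar>m1 t\<bar> + \<bar>m2 t\<bar>) ^ p \<le> 2 ^ p * (\<bar>m1 t\<bar> ^ p + \<bar>m2 t\<bar> ^ p)" for t
    proof -
      have "(\<bar>m1 t\<bar> + \<bar>m2 t\<bar>) ^ p \<le> (2 * max \<bar>m1 t\<bar> \<bar>m2 t\<bar>) ^ p"
        by (rule power_mono) auto
      also have "\<dots> = 2 ^ p * (max \<bar>m1 t\<bar> \<bar>m2 t\<bar>) ^ p"
        by (simp add: power_mult_distrib)
      also have "(max \<bar>m1 t\<bar> \<bar>m2 t\<bar>) ^ p \<le> \<bar>m1 t\<bar> ^ p + \<bar>m2 t\<bar> ^ p"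
        by (auto simp: max_def)
      finally show ?thesis by simp
    qed
    then show "AE t in lebesgue. t \<in> {a..b} \<longrightarrow>
        norm (\<bar>\<bar>m1 t\<bar> + \<bar>m2 t\<bar>\<bar> ^ p) \<le> norm (2 ^ p * (\<bar>m1 t\<bar> ^ p + \<bar>m2 t\<bar> ^ p))"
      by (auto simp: abs_mult)
    show "set_borel_measurable lebesgue {a..b} (\<lambda>t. \<bar>\<bar>m1 t\<bar> + \<bar>m2 t\<bar>\<bar> ^ p)"
      unfolding set_borel_measurable_def
      by (intro borel_measurable_scaleR borel_measurable_indicator borel_measurable_power
          borel_measurable_abs borel_measurable_add) auto
  qed
  moreover have "(\<lambda>t. \<bar>m1 t\<bar> + \<bar>m2 t\<bar>) \<in> borel_measurable lebesgue"
    by measurable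
  ultimately show ?thesis
    by (auto simp: Lp_loc_def)
qed

text \<open>On a bounded interval the constant \<open>1\<close> is integrable. It covers the times
  where \<open>m\<close> has absolute value at most \<open>1\<close>; at all others that value is at
  most its own \<open>p\<close>-th power.\<close>

lemma Lp_loc_imp_L1_loc:
  assumes "m \<in> Lp_loc p" "1 \<le> p"
  shows "m \<in> Lp_loc 1"
proof -
  have [measurable]: "m \<in> borel_measurable lebesgue"
    using assms by (auto simp: Lp_loc_def)
  have "set_integrable lebesgue {a..b} (\<lambda>t. \<bar>m t\<bar> ^ 1)" for a b
  proof (rule set_integrable_bound)
    have "set_integrable lebesgue {a..b} (\<lambda>t. 1 :: real)"
      by (rule absolutely_integrable_on_const) simp
    then show "set_integrable lebesgue {a..b} (\<lambda>t. 1 + \<bar>m t\<bar> ^ p)"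
      using assms by (auto simp: Lp_loc_def)
    have "\<bar>m t\<bar> \<le> 1 + \<bar>m t\<bar> ^ p" for t
    proof (cases "\<bar>m t\<bar> \<le> 1")
      case True
      then show ?thesis by (simp add: add_increasing2)
    next
      case False
      then have "\<bar>m t\<bar> ^ 1 \<le> \<bar>m t\<bar> ^ p"
        using assms(2) by (intro power_increasing) auto
      then show ?thesis by simp
    qed
    then show "AE t in lebesgue. t \<in> {a..b} \<longrightarrow> norm (\<bar>m t\<bar> ^ 1) \<le> norm (1 + \<bar>m t\<bar> ^ p)"
      by (auto simp: add_nonneg_nonneg)
    show "set_borel_measurable lebesgue {a..b} (\<lambda>t. \<bar>m t\<bar> ^ 1)"
      unfolding set_borel_measurable_def
      by (intro borel_measurable_scaleR borel_measurable_indicator borel_measurable_power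
          borel_measurable_abs borel_measurable_add) auto
  qed
  then show ?thesis
    by (auto simp: Lp_loc_def)
qed

text \<open>Existence, uniqueness and the continuity argument use locally integrable bounds only and
  are stated for \<open>LC 1\<close>; the exponent matters just for the seminorms of
  \<open>T_ThetaB\<close>.\<close>

lemma LC_subset_LC1:
  assumes "1 \<le> p"
  shows "LC p \<subseteq> LC 1"
  using Lp_loc_imp_L1_loc[OF _ assms] unfolding LC_def by blast

text \<open>The topologies measure \<open>fs n - f\<close>, and the real suprema in the seminorms
  are shown to be bounded above for members of \<open>LC\<close>.\<close>

lemma LC_diff:
  fixes f g :: "('n::finite) delay_rhs"
  assumes "f \<in> LC p" "g \<in> LC p"
  shows "f - g \<in> LC p"
proof -
  have [measurable]: "(\<lambda>(t, z). f t z) \<in> borel_measurable borel"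
    "(\<lambda>(t, z). g t z) \<in> borel_measurable borel"
    using assms by (auto simp: LC_def)
  have "(\<lambda>w. (\<lambda>(t, z). f t z) w - (\<lambda>(t, z). g t z) w) \<in> borel_measurable borel"
    by measurable
  then have "(\<lambda>(t, z). (f - g) t z) \<in> borel_measurable borel"
    by (simp add: case_prod_beta')
  moreover have "\<exists>m \<in> Lp_loc p. \<exists>l \<in> Lp_loc p. AE t in lebesgue.
        (\<forall>z \<in> K. norm ((f - g) t z) \<le> m t) \<and>
        (\<forall>z1 \<in> K. \<forall>z2 \<in> K. norm ((f - g) t z1 - (f - g) t z2) \<le> l t * norm (z1 - z2))"
    if K: "compact K" for K
  proof -
    obtain m1 l1 where 1: "m1 \<in> Lp_loc p" "l1 \<in> Lp_loc p" "AE t in lebesgue.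
        (\<forall>z \<in> K. norm (f t z) \<le> m1 t) \<and>
        (\<forall>z1 \<in> K. \<forall>z2 \<in> K. norm (f t z1 - f t z2) \<le> l1 t * norm (z1 - z2))"
      using assms(1) K unfolding LC_def by blast
    obtain m2 l2 where 2: "m2 \<in> Lp_loc p" "l2 \<in> Lp_loc p" "AE t in lebesgue.
        (\<forall>z \<in> K. norm (g t z) \<le> m2 t) \<and>
        (\<forall>z1 \<in> K. \<forall>z2 \<in> K. norm (g t z1 - g t z2) \<le> l2 t * norm (z1 - z2))"
      using assms(2) K unfolding LC_def by blast
    show ?thesis
    proof (rule bexI[OF bexI[OF _ Lp_loc_add[OF 1(2) 2(2)]] Lp_loc_add[OF 1(1) 2(1)]])
      show "AE t in lebesgue. (\<forall>z \<in> K. norm ((f - g) t z) \<le> \<bar>m1 t\<bar> + \<bar>m2 t\<bar>) \<and>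
        (\<forall>z1 \<in> K. \<forall>z2 \<in> K. norm ((f - g) t z1 - (f - g) t z2) \<le> (\<bar>l1 t\<bar> + \<bar>l2 t\<bar>) * norm (z1 - z2))"
        using 1(3) 2(3)
      proof eventually_elim
        case (elim t)
        have "norm (f t z - g t z) \<le> \<bar>m1 t\<bar> + \<bar>m2 t\<bar>" if "z \<in> K" for z
          using elim that norm_triangle_ineq4[of "f t z" "g t z"] by fastforce
        moreover have "norm (f t z1 - g t z1 - (f t z2 - g t z2)) \<le> (\<bar>l1 t\<bar> + \<bar>l2 t\<bar>) * norm (z1 - z2)"
          if z: "z1 \<in> K" "z2 \<in> K" for z1 z2
        proof -
          have "norm (f t z1 - g t z1 - (f t z2 - g t z2))
              \<le> norm (f t z1 - f t z2) + norm (g t z1 - g t z2)"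
            by (rule order_trans[OF _ norm_triangle_ineq4]) (simp add: algebra_simps)
          also have "\<dots> \<le> l1 t * norm (z1 - z2) + l2 t * norm (z1 - z2)"
            using elim z by (intro add_mono) auto
          also have "\<dots> \<le> (\<bar>l1 t\<bar> + \<bar>l2 t\<bar>) * norm (z1 - z2)"
            unfolding distrib_right by (intro add_mono mult_right_mono) auto
          finally show ?thesis .
        qed
        ultimately show ?case by simp
      qed
    qed
  qed
  ultimately show ?thesis
    unfolding LC_def by blast
qed

text \<open>Absolute values make both bounds nonnegative at every time, so later monotonicity
  arguments need no exceptional set for their sign.\<close>

lemma LC1_bounds:
  fixes f :: "('n::finite) delay_rhs"
  assumes "f \<in> LC 1"
  obtains m l where
    "\<And>a b. set_integrable lebesgue {a..b} m" "\<And>a b. set_integrable lebesgue {a..b} l"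
    "\<And>t. 0 \<le> m t" "\<And>t. 0 \<le> l t"
    "AE t in lebesgue. (\<forall>z \<in> cball 0 r. norm (f t z) \<le> m t) \<and>
      (\<forall>z1 \<in> cball 0 r. \<forall>z2 \<in> cball 0 r. norm (f t z1 - f t z2) \<le> l t * norm (z1 - z2))"
proof -
  obtain m l where ml: "m \<in> Lp_loc 1" "l \<in> Lp_loc 1" "AE t in lebesgue.
        (\<forall>z \<in> cball 0 r. norm (f t z) \<le> m t) \<and>
        (\<forall>z1 \<in> cball 0 r. \<forall>z2 \<in> cball 0 r. norm (f t z1 - f t z2) \<le> l t * norm (z1 - z2))"
    using assms compact_cball unfolding LC_def by blast
  have "AE t in lebesgue. (\<forall>z \<in> cball 0 r. norm (f t z) \<le> \<bar>m t\<bar>) \<and>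
      (\<forall>z1 \<in> cball 0 r. \<forall>z2 \<in> cball 0 r. norm (f t z1 - f t z2) \<le> \<bar>l t\<bar> * norm (z1 - z2))"
    using ml(3)
  proof eventually_elim
    case (elim t)
    have "l t * norm (z1 - z2) \<le> \<bar>l t\<bar> * norm (z1 - z2)" for z1 z2 :: "(real ^ 'n) \<times> (real ^ 'n)"
      by (intro mult_right_mono) auto
    moreover have "m t \<le> \<bar>m t\<bar>"
      by simp
    ultimately show ?case
      using elim by (meson order_trans)
  qed
  then show thesis
    using ml(1,2) by (intro that[of "\<lambda>t. \<bar>m t\<bar>" "\<lambda>t. \<bar>l t\<bar>"]) (auto simp: Lp_loc_def)
qed

text \<open>\<open>f\<close> is jointly Borel and may be composed with a Lebesgue measurable map
  into the product. Cutting \<open>z\<close> off to \<open>0\<close> outside the interval makes that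
  map measurable on the whole line, and the outer indicator hides the value \<open>f s 0\<close>
  taken there.\<close>

lemma set_borel_measurable_rhs:
  fixes f :: "('n::finite) delay_rhs"
  assumes f: "f \<in> LC p" and z: "set_borel_measurable lebesgue {a..b} z"
  shows "set_borel_measurable lebesgue {a..b} (\<lambda>s. f s (z s))"
proof -
  have f'[measurable]: "(\<lambda>(t, z). f t z) \<in> borel_measurable borel"
    using f by (auto simp: LC_def)
  have z'[measurable]: "(\<lambda>s. indicator {a..b} s *\<^sub>R z s) \<in> borel_measurable lebesgue"
    using z by (simp add: set_borel_measurable_def)
  have "(\<lambda>s::real. s) \<in> borel_measurable lebesgue"
    by (rule measurable_completion) simp
  then have "(\<lambda>s. (s, indicator {a..b} s *\<^sub>R z s)) \<in> borel_measurable lebesgue"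
    using z' by (rule borel_measurable_Pair)
  from measurable_compose[OF this f']
  have "(\<lambda>s. f s (indicator {a..b} s *\<^sub>R z s)) \<in> borel_measurable lebesgue"
    by simp
  then have "(\<lambda>s. indicator {a..b} s *\<^sub>R f s (indicator {a..b} s *\<^sub>R z s)) \<in> borel_measurable lebesgue"
    by (intro borel_measurable_scaleR borel_measurable_indicator) auto
  also have "(\<lambda>s. indicator {a..b} s *\<^sub>R f s (indicator {a..b} s *\<^sub>R z s)) =
      (\<lambda>s. indicator {a..b} s *\<^sub>R f s (z s))"
    by (auto simp: indicator_def)
  finally show ?thesis
    by (simp add: set_borel_measurable_def)
qed

text \<open>Besides continuous curves this has to admit step functions as delayed argument, hence a
  measurable bounded \<open>z\<close>.\<close>

lemma set_integrable_rhs: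
  fixes f :: "('n::finite) delay_rhs"
  assumes f: "f \<in> LC 1" and z: "set_borel_measurable lebesgue {a..b} z"
    and r: "\<And>s. s \<in> {a..b} \<Longrightarrow> norm (z s) \<le> r"
  shows "set_integrable lebesgue {a..b} (\<lambda>s. f s (z s))"
proof -
  obtain m l where ml: "\<And>a b. set_integrable lebesgue {a..b} m" "\<And>a b. set_integrable lebesgue {a..b} l"
    "\<And>t. 0 \<le> m t" "\<And>t. 0 \<le> l t"
    "AE t in lebesgue. (\<forall>z \<in> cball 0 r. norm (f t z) \<le> m t) \<and>
      (\<forall>z1 \<in> cball 0 r. \<forall>z2 \<in> cball 0 r. norm (f t z1 - f t z2) \<le> l t * norm (z1 - z2))"
    by (rule LC1_bounds[OF f that])
  show ?thesis
  proof (rule set_integrable_bound[OF ml(1) set_borel_measurable_rhs[OF f z]])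
    show "AE x in lebesgue. x \<in> {a..b} \<longrightarrow> norm (f x (z x)) \<le> norm (m x)"
      using ml(5)
    proof eventually_elim
      case (elim t)
      show ?case
      proof
        assume "t \<in> {a..b}"
        then have "norm (f t (z t)) \<le> m t"
          using r elim by simp
        then show "norm (f t (z t)) \<le> norm (m t)"
          by simp
      qed
    qed
  qed
qed

lemma set_borel_measurable_lebesgue_continuous:
  fixes z :: "real \<Rightarrow> 'a::real_normed_vector"
  assumes "continuous_on {a..b} z"
  shows "set_borel_measurable lebesgue {a..b} z"
  using borel_measurable_continuous_on_indicator[OF _ assms]
  unfolding set_borel_measurable_def by (simp add: measurable_completion)

lemma continuous_on_delay_pair:
  fixes x y :: "real \<Rightarrow> 'a::topological_space"
  assumes "continuous_on {a..b} x" "continuous_on {a-1..b-1} y"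
  shows "continuous_on {a..b} (\<lambda>s. (x s, y (s - 1)))"
  by (intro continuous_intros assms(1) continuous_on_compose2[OF assms(2)]) auto

lemma norm_Pair_le_ball:
  assumes "norm x \<le> real j + 1" "norm y \<le> real j + 1"
  shows "norm (x, y) \<le> real (2 * j + 2)"
  using norm_Pair_le[of x y] assms by simp

lemma set_integrable_delay:
  fixes f :: "('n::finite) delay_rhs"
  assumes f: "f \<in> LC 1" and x: "continuous_on {a..b} x" and y: "continuous_on {a-1..b-1} y"
  shows "set_integrable lebesgue {a..b} (\<lambda>s. f s (x s, y (s - 1)))"
proof -
  have c: "continuous_on {a..b} (\<lambda>s. (x s, y (s - 1)))"
    by (rule continuous_on_delay_pair[OF x y])
  then have "bounded ((\<lambda>s. (x s, y (s - 1))) ` {a..b})"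
    by (intro compact_imp_bounded compact_continuous_image) auto
  then obtain r where "\<And>s. s \<in> {a..b} \<Longrightarrow> norm (x s, y (s - 1)) \<le> r"
    unfolding bounded_iff by blast
  then show ?thesis
    by (intro set_integrable_rhs[OF f set_borel_measurable_lebesgue_continuous[OF c]])
qed

section \<open>Integrals over intervals: additivity, absolute continuity, norm bounds\<close>

lemma set_integral_combine:
  fixes g :: "real \<Rightarrow> 'a::euclidean_space"
  assumes "set_integrable lebesgue {a..b} g" "a \<le> c" "c \<le> b"
  shows "(LINT s:{a..b}|lebesgue. g s) = (LINT s:{a..c}|lebesgue. g s) + (LINT s:{c..b}|lebesgue. g s)"
proof -
  have "set_integrable lebesgue {a..c} g" "set_integrable lebesgue {c..b} g"
    using assms by (auto intro: set_integrable_subset)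
  then show ?thesis
    using Henstock_Kurzweil_Integration.integral_combine[of a c b g] assms
    by (simp add: set_lebesgue_integral_eq_integral)
qed

lemma continuous_on_set_integral:
  fixes g :: "real \<Rightarrow> 'a::euclidean_space"
  assumes "set_integrable lebesgue {a..b} g"
  shows "continuous_on {a..b} (\<lambda>t. LINT s:{a..t}|lebesgue. g s)"
proof -
  have "continuous_on {a..b} (\<lambda>t. integral {a..t} g)"
    using assms by (intro indefinite_integral_continuous_1 set_lebesgue_integral_eq_integral)
  then show ?thesis
  proof (rule continuous_on_eq)
    fix t assume "t \<in> {a..b}"
    then have "set_integrable lebesgue {a..t} g"
      using assms by (auto intro: set_integrable_subset)
    then show "integral {a..t} g = (LINT s:{a..t}|lebesgue. g s)"
      by (simp add: set_lebesgue_integral_eq_integral)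
  qed
qed

text \<open>The primitive is uniformly continuous on the compact interval \<open>{0..r}\<close>, so
  one \<rho> serves all positions of the short interval.\<close>

lemma small_set_integrals:
  fixes l :: "real \<Rightarrow> real"
  assumes l: "\<And>a b. set_integrable lebesgue {a..b} l" and "0 < \<epsilon>"
  shows "\<exists>\<rho>>0. \<forall>a b. 0 \<le> a \<and> a \<le> b \<and> b \<le> r \<and> b - a < \<rho> \<longrightarrow> (LINT s:{a..b}|lebesgue. l s) < \<epsilon>"
proof -
  have "uniformly_continuous_on {0..r} (\<lambda>t. LINT s:{0..t}|lebesgue. l s)"
    by (intro compact_uniformly_continuous continuous_on_set_integral l) auto
  then obtain \<rho> where \<rho>: "\<rho> > 0" "\<And>a b. a \<in> {0..r} \<Longrightarrow> b \<in> {0..r} \<Longrightarrow> dist b a < \<rho> \<Longrightarrow>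
      dist (LINT s:{0..b}|lebesgue. l s) (LINT s:{0..a}|lebesgue. l s) < \<epsilon>"
    using \<open>0 < \<epsilon>\<close> unfolding uniformly_continuous_on_def by metis
  have "(LINT s:{a..b}|lebesgue. l s) < \<epsilon>" if "0 \<le> a" "a \<le> b" "b \<le> r" "b - a < \<rho>" for a b
    using \<rho>(2)[of a b] that set_integral_combine[OF l[of 0 b], of a] by (auto simp: dist_real_def)
  with \<rho>(1) show ?thesis by blast
qed

text \<open>The weight \<open>w\<close> need not be measurable: the optimal bounds enter only through this inequality.\<close>

lemma norm_set_integral_le_nn_integral:
  fixes g :: "real \<Rightarrow> 'a::{banach, second_countable_topology}"
  assumes g: "set_integrable lebesgue S g"
    and w: "\<And>s. s \<in> S \<Longrightarrow> ennreal (norm (g s)) \<le> w s"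
  shows "ennreal (norm (LINT s:S|lebesgue. g s)) \<le> (\<integral>\<^sup>+s\<in>S. w s \<partial>lebesgue)"
proof -
  have "ennreal (norm (LINT s:S|lebesgue. g s)) \<le> (\<integral>\<^sup>+s. ennreal (norm (indicator S s *\<^sub>R g s)) \<partial>lebesgue)"
    using g unfolding set_integrable_def set_lebesgue_integral_def
    by (rule integral_norm_bound_ennreal)
  also have "\<dots> \<le> (\<integral>\<^sup>+s\<in>S. w s \<partial>lebesgue)"
    using w by (intro nn_integral_mono) (auto split: split_indicator)
  finally show ?thesis .
qed

lemma norm_set_integral_le:
  fixes g :: "real \<Rightarrow> 'a::{banach, second_countable_topology}" and h :: "real \<Rightarrow> real"
  assumes g: "set_integrable lebesgue S g" and h: "set_integrable lebesgue S h"
    and "AE s in lebesgue. s \<in> S \<longrightarrow> norm (g s) \<le> h s"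
  shows "norm (LINT s:S|lebesgue. g s) \<le> (LINT s:S|lebesgue. h s)"
  using set_integral_norm_bound[OF g] set_integral_mono_AE[OF set_integrable_norm[OF g] h assms(3)]
  by linarith

subsection \<open>Local existence and comparison\<close>

text \<open>The start \<open>a\<close> is arbitrary and the past on \<open>{a-1..a}\<close> consists
  of the values of \<open>x\<close> itself, so that solutions can be restricted and glued. For
  \<open>f \<in> LC 1\<close> the integrals are genuine: integrability follows from continuity by
  \<open>set_integrable_delay_self\<close>.\<close>

definition solves_on :: "('n::finite) delay_rhs \<Rightarrow> real \<Rightarrow> real \<Rightarrow> (real \<Rightarrow> real ^ 'n) \<Rightarrow> bool" where
  "solves_on f a b x \<longleftrightarrow> continuous_on {a-1..b} x \<and>
     (\<forall>t \<in> {a..b}. x t = x a + (LINT s:{a..t}|lebesgue. f s (x s, x (s - 1))))"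

lemma solves_onI:
  assumes "continuous_on {a-1..b} x"
    and "\<And>t. t \<in> {a..b} \<Longrightarrow> x t = x a + (LINT s:{a..t}|lebesgue. f s (x s, x (s - 1)))"
  shows "solves_on f a b x"
  using assms unfolding solves_on_def by blast

lemma solves_on_continuous: "solves_on f a b x \<Longrightarrow> continuous_on {a-1..b} x"
  unfolding solves_on_def by blast

lemma solves_on_eq:
  assumes "solves_on f a b x" "a \<le> t" "t \<le> b"
  shows "x t = x a + (LINT s:{a..t}|lebesgue. f s (x s, x (s - 1)))"
  using assms(2,3) by (intro bspec[OF conjunct2[OF assms(1)[unfolded solves_on_def]], of t]) simp

lemma set_integrable_delay_self:
  fixes f :: "('n::finite) delay_rhs"
  assumes "f \<in> LC 1" "continuous_on {a-1..b} x" "a \<le> c"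
  shows "set_integrable lebesgue {c..b} (\<lambda>s. f s (x s, x (s - 1)))"
  by (intro set_integrable_delay assms(1) continuous_on_subset[OF assms(2)]) (use assms(3) in auto)

lemma solves_on_subinterval:
  fixes f :: "('n::finite) delay_rhs"
  assumes f: "f \<in> LC 1" and x: "solves_on f a b x" and le: "a \<le> c" "c \<le> d" "d \<le> b"
  shows "solves_on f c d x"
proof -
  have cont: "continuous_on {a-1..b} x"
    using x by (rule solves_on_continuous)
  have "x t = x c + (LINT s:{c..t}|lebesgue. f s (x s, x (s - 1)))" if t: "t \<in> {c..d}" for t
  proof -
    have "set_integrable lebesgue {a..t} (\<lambda>s. f s (x s, x (s - 1)))"
      by (rule set_integrable_subset[OF set_integrable_delay_self[OF f cont order_refl]])
        (use t le in auto)
    from set_integral_combine[OF this, of c]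
    have "(LINT s:{a..t}|lebesgue. f s (x s, x (s - 1))) =
        (LINT s:{a..c}|lebesgue. f s (x s, x (s - 1))) + (LINT s:{c..t}|lebesgue. f s (x s, x (s - 1)))"
      using t le by simp
    moreover have "x t = x a + (LINT s:{a..t}|lebesgue. f s (x s, x (s - 1)))"
        "x c = x a + (LINT s:{a..c}|lebesgue. f s (x s, x (s - 1)))"
      using x t le by (auto intro!: solves_on_eq)
    ultimately show ?thesis by simp
  qed
  moreover have "continuous_on {c-1..d} x"
    using le by (intro continuous_on_subset[OF cont]) auto
  ultimately show ?thesis
    by (intro solves_onI)
qed

lemma solves_on_join:
  fixes f :: "('n::finite) delay_rhs"
  assumes f: "f \<in> LC 1" and 1: "solves_on f a c x" and 2: "solves_on f c b x" and le: "a \<le> c" "c \<le> b"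
  shows "solves_on f a b x"
proof -
  have "continuous_on ({a-1..c} \<union> {c-1..b}) x"
    using 1 2 by (intro continuous_on_closed_Un) (auto intro: solves_on_continuous)
  moreover have "{a-1..c} \<union> {c-1..b} = {a-1..b}"
    using le by auto
  ultimately have cont: "continuous_on {a-1..b} x"
    by simp
  have "x t = x a + (LINT s:{a..t}|lebesgue. f s (x s, x (s - 1)))" if t: "t \<in> {a..b}" for t
  proof (cases "t \<le> c")
    case True
    then show ?thesis using 1 t by (auto intro!: solves_on_eq)
  next
    case False
    have "set_integrable lebesgue {a..t} (\<lambda>s. f s (x s, x (s - 1)))"
      by (rule set_integrable_subset[OF set_integrable_delay_self[OF f cont order_refl]])
        (use t in auto)
    from set_integral_combine[OF this, of c]
    have "(LINT s:{a..t}|lebesgue. f s (x s, x (s - 1))) =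
        (LINT s:{a..c}|lebesgue. f s (x s, x (s - 1))) + (LINT s:{c..t}|lebesgue. f s (x s, x (s - 1)))"
      using False le by simp
    moreover have "x t = x c + (LINT s:{c..t}|lebesgue. f s (x s, x (s - 1)))"
        "x c = x a + (LINT s:{a..c}|lebesgue. f s (x s, x (s - 1)))"
      using 1 2 t False le by (auto intro!: solves_on_eq)
    ultimately show ?thesis by simp
  qed
  with cont show ?thesis
    by (rule solves_onI)
qed

lemma solves_on_cong:
  assumes x: "solves_on f a b x" and eq: "\<And>t. t \<in> {a-1..b} \<Longrightarrow> x t = y t"
  shows "solves_on f a b y"
proof (rule solves_onI)
  show "continuous_on {a-1..b} y"
    using solves_on_continuous[OF x] by (rule continuous_on_eq) (use eq in auto)
  fix t assume t: "t \<in> {a..b}"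
  then have "(LINT s:{a..t}|lebesgue. f s (x s, x (s - 1))) = (LINT s:{a..t}|lebesgue. f s (y s, y (s - 1)))"
    using eq by (intro set_lebesgue_integral_cong) auto
  then show "y t = y a + (LINT s:{a..t}|lebesgue. f s (y s, y (s - 1)))"
    using eq[of t] eq[of a] solves_on_eq[OF x, of t] t by simp
qed

text \<open>The step \<open>\<rho>\<close> is so short that the Lipschitz bound has integral below \<open>1 / 4\<close>; the maximum \<open>w\<close> of
  \<open>\<parallel>y - x\<parallel>\<close> then satisfies \<open>w \<le> e + w / 2\<close>.\<close>

lemma gronwall_step:
  fixes f :: "('n::finite) delay_rhs"
  assumes f: "f \<in> LC 1"
  shows "\<exists>\<rho>>0. \<forall>a b e x y. 0 \<le> a \<and> a \<le> b \<and> b \<le> r \<and> b - a < \<rho> \<and>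
      continuous_on {a-1..b} x \<and> continuous_on {a-1..b} y \<and>
      (\<forall>s \<in> {a-1..b}. norm (x s) \<le> c \<and> norm (y s) \<le> c) \<and>
      (\<forall>s \<in> {a-1..a}. norm (y s - x s) \<le> e) \<and>
      (\<forall>t \<in> {a..b}. norm (y t - x t) \<le>
         e + norm (LINT s:{a..t}|lebesgue. f s (y s, y (s - 1)) - f s (x s, x (s - 1)))) \<longrightarrow>
      (\<forall>s \<in> {a-1..b}. norm (y s - x s) \<le> 2 * e)"
proof -
  obtain m l where ml: "\<And>a b. set_integrable lebesgue {a..b} m" "\<And>a b. set_integrable lebesgue {a..b} l"
    "\<And>t. 0 \<le> m t" "\<And>t. 0 \<le> l t"
    "AE t in lebesgue. (\<forall>z \<in> cball 0 (2 * c). norm (f t z) \<le> m t) \<and>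
      (\<forall>z1 \<in> cball 0 (2 * c). \<forall>z2 \<in> cball 0 (2 * c). norm (f t z1 - f t z2) \<le> l t * norm (z1 - z2))"
    by (rule LC1_bounds[OF f that])
  obtain \<rho> where \<rho>: "\<rho> > 0" "\<And>a b. 0 \<le> a \<Longrightarrow> a \<le> b \<Longrightarrow> b \<le> r \<Longrightarrow> b - a < \<rho> \<Longrightarrow>
      (LINT s:{a..b}|lebesgue. l s) < 1 / 4"
    using small_set_integrals[OF ml(2), of "1/4" r] by auto
  have "\<forall>s \<in> {a-1..b}. norm (y s - x s) \<le> 2 * e"
    if le: "0 \<le> a" "a \<le> b" "b \<le> r" "b - a < \<rho>"
      and x: "continuous_on {a-1..b} x" and y: "continuous_on {a-1..b} y"
      and c': "\<forall>s \<in> {a-1..b}. norm (x s) \<le> c \<and> norm (y s) \<le> c"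
      and e1': "\<forall>s \<in> {a-1..a}. norm (y s - x s) \<le> e"
      and e2': "\<forall>t \<in> {a..b}. norm (y t - x t) \<le>
         e + norm (LINT s:{a..t}|lebesgue. f s (y s, y (s - 1)) - f s (x s, x (s - 1)))"
    for a b e and x y :: "real \<Rightarrow> real ^ 'n"
  proof -
    note c = bspec[OF c'] and e1 = bspec[OF e1'] and e2 = bspec[OF e2']
    have "norm (y a - x a) \<le> e"
      by (rule e1) simp
    then have "0 \<le> e"
      using norm_ge_zero order_trans by blast
    have "continuous_on {a-1..b} (\<lambda>s. norm (y s - x s))"
      by (intro continuous_intros x y)
    \<comment> \<open>The maximum includes the past, because the delayed difference
      \<open>y (s - 1) - x (s - 1)\<close> has to be controlled by the same number.\<close>
    then obtain t where t: "t \<in> {a-1..b}" and max: "\<And>s. s \<in> {a-1..b} \<Longrightarrow> norm (y s - x s) \<le> norm (y t - x t)"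
      using continuous_attains_sup[of "{a-1..b}" "\<lambda>s. norm (y s - x s)"] le by auto
    define w where "w = norm (y t - x t)"
    have "w \<le> 2 * e"
    proof (cases "t \<le> a")
      case True
      then have "w \<le> e" using e1[of t] t by (auto simp: w_def)
      with \<open>0 \<le> e\<close> show ?thesis by linarith
    next
      case False
      have xt: "continuous_on {a-1..t} x" and yt: "continuous_on {a-1..t} y"
        using x y t by (auto intro: continuous_on_subset)
      have "norm (LINT s:{a..t}|lebesgue. f s (y s, y (s - 1)) - f s (x s, x (s - 1)))
          \<le> (LINT s:{a..t}|lebesgue. l s * (2 * w))"
      proof (rule norm_set_integral_le)
        show "set_integrable lebesgue {a..t} (\<lambda>s. f s (y s, y (s - 1)) - f s (x s, x (s - 1)))"
          by (intro set_integral_diff(1) set_integrable_delay_self[OF f yt order_refl]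
              set_integrable_delay_self[OF f xt order_refl])
        show "set_integrable lebesgue {a..t} (\<lambda>s. l s * (2 * w))"
          using ml(2) by auto
        show "AE s in lebesgue. s \<in> {a..t} \<longrightarrow> norm (f s (y s, y (s - 1)) - f s (x s, x (s - 1))) \<le> l s * (2 * w)"
          using ml(5)
        proof eventually_elim
          case (elim s)
          show ?case
          proof
            assume s: "s \<in> {a..t}"
            then have mem: "s \<in> {a-1..b}" "s - 1 \<in> {a-1..b}"
              using t le by auto
            have "norm (x s, x (s - 1)) \<le> 2 * c" "norm (y s, y (s - 1)) \<le> 2 * c"
              using norm_Pair_le[of "x s" "x (s - 1)"] norm_Pair_le[of "y s" "y (s - 1)"]
                c[OF mem(1)] c[OF mem(2)] by linarith+
            then have "norm (f s (y s, y (s - 1)) - f s (x s, x (s - 1)))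
                \<le> l s * norm ((y s, y (s - 1)) - (x s, x (s - 1)))"
              by (intro elim[THEN conjunct2, rule_format]) (simp_all only: mem_cball_0)
            \<comment> \<open>Each of the two components contributes at most \<open>w\<close>; the
              factor \<open>2\<close> is why the Lipschitz integral was taken below
              \<open>1 / 4\<close> to leave \<open>w / 2\<close>.\<close>
            also have "norm ((y s, y (s - 1)) - (x s, x (s - 1))) \<le> 2 * w"
              using norm_Pair_le[of "y s - x s" "y (s - 1) - x (s - 1)"] max[OF mem(1)] max[OF mem(2)]
              by (simp add: w_def)
            finally show "norm (f s (y s, y (s - 1)) - f s (x s, x (s - 1))) \<le> l s * (2 * w)"
              using ml(4)[of s] by (simp add: mult_left_mono)
          qed
        qed
      qed
      also have "\<dots> = (LINT s:{a..t}|lebesgue. l s) * (2 * w)"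
        by simp
      also have "\<dots> \<le> (1 / 4) * (2 * w)"
        using \<rho>(2)[of a t] le t False by (intro mult_right_mono) (auto simp: w_def)
      finally have "w \<le> e + w / 2"
        using e2[of t] t False by (simp add: w_def)
      then show ?thesis by simp
    qed
    then show ?thesis
      using max unfolding w_def by force
  qed
  then show ?thesis
    using \<rho>(1) by blast
qed

text \<open>That \<open>h\<close> depends only on \<open>r\<close> and \<open>c\<close> makes a bounded solution extendable past a finite end.\<close>

lemma local_existence:
  fixes f :: "('n::finite) delay_rhs"
  assumes f: "f \<in> LC 1"
  shows "\<exists>h>0. \<forall>a x. 0 \<le> a \<and> a \<le> r \<and> continuous_on {a-1..a} x \<and> (\<forall>s \<in> {a-1..a}. norm (x s) \<le> c) \<longrightarrow>
      (\<exists>y. solves_on f a (a + h) y \<and> (\<forall>s \<in> {a-1..a}. y s = x s))"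
proof -
  \<comment> \<open>The iterates stay within distance \<open>1\<close> of \<open>x a\<close>, hence
    below \<open>c + 1\<close>, and the delayed component stays below \<open>c\<close>.\<close>
  define R where "R = 2 * c + 1"
  obtain m l where ml: "\<And>a b. set_integrable lebesgue {a..b} m" "\<And>a b. set_integrable lebesgue {a..b} l"
    "\<And>t. 0 \<le> m t" "\<And>t. 0 \<le> l t"
    "AE t in lebesgue. (\<forall>z \<in> cball 0 R. norm (f t z) \<le> m t) \<and>
      (\<forall>z1 \<in> cball 0 R. \<forall>z2 \<in> cball 0 R. norm (f t z1 - f t z2) \<le> l t * norm (z1 - z2))"
    by (rule LC1_bounds[OF f that])
  obtain \<rho>1 where \<rho>1: "\<rho>1 > 0" "\<And>a b. 0 \<le> a \<Longrightarrow> a \<le> b \<Longrightarrow> b \<le> r + 1 \<Longrightarrow> b - a < \<rho>1 \<Longrightarrow>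
      (LINT s:{a..b}|lebesgue. l s) < 1 / 2"
    using small_set_integrals[OF ml(2), of "1/2" "r + 1"] by auto
  obtain \<rho>2 where \<rho>2: "\<rho>2 > 0" "\<And>a b. 0 \<le> a \<Longrightarrow> a \<le> b \<Longrightarrow> b \<le> r + 1 \<Longrightarrow> b - a < \<rho>2 \<Longrightarrow>
      (LINT s:{a..b}|lebesgue. m s) < 1"
    using small_set_integrals[OF ml(1), of "1" "r + 1"] by auto
  \<comment> \<open>With \<open>h \<le> 1\<close> the delayed argument only meets the given past, so
    the problem is an ordinary differential equation, and \<open>a + h \<le> r + 1\<close>. Below
    \<rho>1 the integral operator contracts by \<open>1 / 2\<close>; below \<rho>2 it maps the unit
    ball around \<open>x a\<close> into itself.\<close>
  define h where "h = min 1 (min \<rho>1 \<rho>2 / 2)"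
  have h: "0 < h" "h \<le> 1" "h < \<rho>1" "h < \<rho>2"
    using \<rho>1(1) \<rho>2(1) by (auto simp: h_def min_def)
  have "\<exists>y. solves_on f a (a + h) y \<and> (\<forall>s \<in> {a-1..a}. y s = x s)"
    if a: "0 \<le> a" "a \<le> r" and x: "continuous_on {a-1..a} x" and c': "\<forall>s \<in> {a-1..a}. norm (x s) \<le> c"
    for a and x :: "real \<Rightarrow> real ^ 'n"
  proof -
    note c = bspec[OF c']
    \<comment> \<open>Clamping time to \<open>{a..a+h}\<close> extends curves to the whole line, so
      that the fixed point can be sought in the complete space of bounded continuous
      functions.\<close>
    define cl where "cl t = max a (min t (a + h))" for t
    have cl: "cl t \<in> {a..a+h}" for t
      using h(1) by (auto simp: cl_def)
    have cl_id: "cl t = t" if "t \<in> {a..a+h}" for t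
      using that by (auto simp: cl_def)
    define I where "I g t = (LINT s:{a..t}|lebesgue. f s (apply_bcontfun g s, x (s - 1)))" for g t
    define G where "G g = Bcontfun (\<lambda>t. x a + I g (cl t))" for g
    define S where "S = PiC UNIV (\<lambda>t::real. cball (x a) 1)"
    have S_iff: "g \<in> S \<longleftrightarrow> (\<forall>t. norm (apply_bcontfun g t - x a) \<le> 1)" for g
      by (auto simp: S_def mem_PiC_iff Pi_iff dist_norm norm_minus_commute)
    have int: "set_integrable lebesgue {a..t} (\<lambda>s. f s (apply_bcontfun g s, x (s - 1)))" if "t \<in> {a..a+h}" for g t
      using that h by (intro set_integrable_delay f continuous_on_subset[OF x]) auto
    have ball: "norm (apply_bcontfun g s, x (s - 1)) \<le> R" if "g \<in> S" "s \<in> {a..a+h}" for g s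
    proof -
      have "norm (apply_bcontfun g s) \<le> norm (x a) + 1"
        using that(1) norm_triangle_sub[of "apply_bcontfun g s" "x a"] unfolding S_iff by (smt (verit))
      moreover have "norm (x a) \<le> c" "norm (x (s - 1)) \<le> c"
        using c that(2) h by auto
      ultimately show ?thesis
        using norm_Pair_le[of "apply_bcontfun g s" "x (s - 1)"] by (simp add: R_def)
    qed
    have I1: "norm (I g t) \<le> 1" if g: "g \<in> S" and t: "t \<in> {a..a+h}" for g t
    proof -
      have "norm (I g t) \<le> (LINT s:{a..t}|lebesgue. m s)"
        unfolding I_def
      proof (rule norm_set_integral_le[OF int[OF t] ml(1)])
        show "AE s in lebesgue. s \<in> {a..t} \<longrightarrow> norm (f s (apply_bcontfun g s, x (s - 1))) \<le> m s"
          using ml(5) by eventually_elim (use ball[OF g] t in auto)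
      qed
      also have "\<dots> \<le> 1"
        using \<rho>2(2)[of a t] t a h by auto
      finally show ?thesis .
    qed
    have "(\<lambda>t. x a + I g (cl t)) \<in> bcontfun" if g: "g \<in> S" for g
    proof (rule bcontfun_normI)
      have "continuous_on {a..a+h} (I g)"
        unfolding I_def by (rule continuous_on_set_integral[OF int]) (use h in auto)
      moreover have "continuous_on UNIV cl"
        unfolding cl_def by (intro continuous_intros)
      ultimately have "continuous_on UNIV (\<lambda>t. I g (cl t))"
        by (rule continuous_on_compose2) (use cl in auto)
      then show "continuous_on UNIV (\<lambda>t. x a + I g (cl t))"
        by (intro continuous_intros)
      show "norm (x a + I g (cl t)) \<le> norm (x a) + 1" for t
        using norm_triangle_ineq[of "x a" "I g (cl t)"] I1[OF g cl, of t] by linarith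
    qed
    then have G: "apply_bcontfun (G g) t = x a + I g (cl t)" if "g \<in> S" for g t
      using that by (simp add: G_def Bcontfun_inverse)
    have "\<exists>!g. g \<in> S \<and> G g = g"
    proof (rule Banach_fix[where c = "1 / 2"])
      show "complete S"
        unfolding S_def complete_eq_closed by (intro closed_PiC) auto
      have "const_bcontfun (x a) \<in> S"
        by (simp add: S_iff const_bcontfun.rep_eq)
      then show "S \<noteq> {}" by blast
      show "G ` S \<subseteq> S"
      proof (rule image_subsetI)
        fix g assume g: "g \<in> S"
        show "G g \<in> S"
          unfolding S_iff using I1[OF g cl] by (simp add: G[OF g])
      qed
      show "dist (G g1) (G g2) \<le> (1 / 2) * dist g1 g2" if g: "g1 \<in> S" "g2 \<in> S" for g1 g2
      proof (rule dist_bound)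
        fix t
        have "I g1 (cl t) - I g2 (cl t) = (LINT s:{a..cl t}|lebesgue.
            f s (apply_bcontfun g1 s, x (s - 1)) - f s (apply_bcontfun g2 s, x (s - 1)))"
          unfolding I_def by (intro set_integral_diff(2)[symmetric] int cl)
        also have "norm \<dots> \<le> (LINT s:{a..cl t}|lebesgue. l s * dist g1 g2)"
        proof (rule norm_set_integral_le)
          show "set_integrable lebesgue {a..cl t} (\<lambda>s. f s (apply_bcontfun g1 s, x (s - 1)) - f s (apply_bcontfun g2 s, x (s - 1)))"
            by (intro set_integral_diff int cl)
          show "set_integrable lebesgue {a..cl t} (\<lambda>s. l s * dist g1 g2)"
            using ml(2) by auto
          show "AE s in lebesgue. s \<in> {a..cl t} \<longrightarrow>
              norm (f s (apply_bcontfun g1 s, x (s - 1)) - f s (apply_bcontfun g2 s, x (s - 1))) \<le> l s * dist g1 g2"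
            using ml(5)
          proof eventually_elim
            case (elim s)
            show ?case
            proof
              assume s: "s \<in> {a..cl t}"
              then have "s \<in> {a..a+h}"
                using cl[of t] by auto
              then have "norm (f s (apply_bcontfun g1 s, x (s - 1)) - f s (apply_bcontfun g2 s, x (s - 1)))
                  \<le> l s * norm ((apply_bcontfun g1 s, x (s - 1)) - (apply_bcontfun g2 s, x (s - 1)))"
                using elim ball[OF g(1)] ball[OF g(2)]
                by (intro elim[THEN conjunct2, rule_format]) (simp_all only: mem_cball_0)
              also have "norm ((apply_bcontfun g1 s, x (s - 1)) - (apply_bcontfun g2 s, x (s - 1))) =
                  dist (apply_bcontfun g1 s) (apply_bcontfun g2 s)"
                by (simp add: norm_Pair dist_norm)
              also have "l s * dist (apply_bcontfun g1 s) (apply_bcontfun g2 s) \<le> l s * dist g1 g2"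
                by (intro mult_left_mono dist_bounded ml(4))
              finally show "norm (f s (apply_bcontfun g1 s, x (s - 1)) - f s (apply_bcontfun g2 s, x (s - 1))) \<le> l s * dist g1 g2" .
            qed
          qed
        qed
        also have "\<dots> = (LINT s:{a..cl t}|lebesgue. l s) * dist g1 g2"
          by simp
        also have "\<dots> \<le> (1 / 2) * dist g1 g2"
          using \<rho>1(2)[of a "cl t"] cl[of t] a h by (intro mult_right_mono) auto
        finally show "dist (apply_bcontfun (G g1) t) (apply_bcontfun (G g2) t) \<le> (1 / 2) * dist g1 g2"
          using g by (simp add: G dist_norm)
      qed
    qed auto
    then obtain g where g: "g \<in> S" "G g = g"
      by blast
    then have g_eq: "apply_bcontfun g t = x a + I g t" if "t \<in> {a..a+h}" for t
      using G[OF g(1), of t] that by (simp add: cl_id)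
    define y where "y t = (if t \<le> a then x t else apply_bcontfun g t)" for t
    have "set_integrable lebesgue {a..a} (\<lambda>s. f s (apply_bcontfun g s, x (s - 1)))"
      using int[of a g] h by simp
    then have "I g a = 0"
      by (simp add: I_def set_lebesgue_integral_eq_integral)
    then have ga: "apply_bcontfun g a = x a"
      using g_eq[of a] h(1) by simp
    have y_ge: "y t = apply_bcontfun g t" if "t \<ge> a" for t
      using that ga by (auto simp: y_def)
    have "continuous_on ({a-1..a} \<union> {a..a+h}) y"
    proof (rule continuous_on_closed_Un)
      show "continuous_on {a-1..a} y"
        using x by (rule continuous_on_eq) (auto simp: y_def)
      have "continuous_on {a..a+h} (apply_bcontfun g)" by simp
      then show "continuous_on {a..a+h} y"
        by (rule continuous_on_eq) (auto simp: y_ge)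
    qed auto
    moreover have "{a-1..a} \<union> {a..a+h} = {a-1..a+h}"
      using h(1) by auto
    ultimately have "continuous_on {a-1..a+h} y"
      by simp
    moreover have "y t = y a + (LINT s:{a..t}|lebesgue. f s (y s, y (s - 1)))" if t: "t \<in> {a..a+h}" for t
    proof -
      have "(LINT s:{a..t}|lebesgue. f s (y s, y (s - 1))) = I g t"
        unfolding I_def using t h by (intro set_lebesgue_integral_cong) (auto simp: y_ge, simp add: y_def)
      then show ?thesis
        using g_eq[OF t] t ga by (simp add: y_ge)
    qed
    ultimately have "solves_on f a (a + h) y"
      by (rule solves_onI)
    moreover have "\<forall>s \<in> {a-1..a}. y s = x s"
      by (simp add: y_def)
    ultimately show ?thesis by blast
  qed
  with h(1) show ?thesis
    by blast
qed

subsection \<open>Maximal solutions\<close>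

text \<open>\<open>gronwall_step\<close> with error \<open>e = 0\<close> propagates agreement over
  steps of length \<open>\<rho> / 2\<close>, where \<rho> depends only on \<open>T\<close> and a
  common bound of both solutions.\<close>

lemma solves_on_unique:
  fixes f :: "('n::finite) delay_rhs"
  assumes f: "f \<in> LC 1" and x: "solves_on f 0 T x" and y: "solves_on f 0 T y" and "0 \<le> T"
    and init: "\<And>s. s \<in> {-1..0} \<Longrightarrow> x s = y s" and t: "t \<in> {-1..T}"
  shows "x t = y t"
proof -
  have xc: "continuous_on {-1..T} x" and yc: "continuous_on {-1..T} y"
    using solves_on_continuous[OF x] solves_on_continuous[OF y] by auto
  have "bounded (x ` {-1..T} \<union> y ` {-1..T})"
    using xc yc by (simp add: compact_imp_bounded compact_continuous_image)
  then obtain c where c: "\<And>s. s \<in> {-1..T} \<Longrightarrow> norm (x s) \<le> c \<and> norm (y s) \<le> c"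
    unfolding bounded_iff by blast
  obtain \<rho> where \<rho>: "\<rho> > 0" "\<forall>a b e x y. 0 \<le> a \<and> a \<le> b \<and> b \<le> T \<and> b - a < \<rho> \<and>
      continuous_on {a-1..b} x \<and> continuous_on {a-1..b} y \<and>
      (\<forall>s \<in> {a-1..b}. norm (x s) \<le> c \<and> norm (y s) \<le> c) \<and>
      (\<forall>s \<in> {a-1..a}. norm (y s - x s) \<le> e) \<and>
      (\<forall>t \<in> {a..b}. norm (y t - x t) \<le>
         e + norm (LINT s:{a..t}|lebesgue. f s (y s, y (s - 1)) - f s (x s, x (s - 1)))) \<longrightarrow>
      (\<forall>s \<in> {a-1..b}. norm (y s - x s) \<le> 2 * e)"
    using gronwall_step[OF f, of T c] by blast
  have agree: "\<forall>s \<in> {-1..min T (real k * (\<rho> / 2))}. x s = y s" for k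
  proof (induction k)
    case 0
    then show ?case using init \<open>0 \<le> T\<close> by auto
  next
    case (Suc k)
    define a where "a = min T (real k * (\<rho> / 2))"
    define b where "b = min T (real (Suc k) * (\<rho> / 2))"
    have ab: "0 \<le> a" "a \<le> b" "b \<le> T" "b - a < \<rho>"
      using \<rho>(1) \<open>0 \<le> T\<close> by (auto simp: a_def b_def min_def algebra_simps)
    have IH: "\<And>s. s \<in> {-1..a} \<Longrightarrow> x s = y s"
      using Suc by (simp add: a_def)
    have x': "solves_on f a b x" and y': "solves_on f a b y"
      using solves_on_subinterval[OF f x] solves_on_subinterval[OF f y] ab by auto
    note cont = solves_on_continuous[OF x'] solves_on_continuous[OF y']
    have diff: "norm (y t - x t) \<le> 0 + norm (LINT s:{a..t}|lebesgue. f s (y s, y (s - 1)) - f s (x s, x (s - 1)))"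
      if t: "t \<in> {a..b}" for t
    proof -
      have "continuous_on {a-1..t} x" "continuous_on {a-1..t} y"
        using t by (auto intro: continuous_on_subset[OF cont(1)] continuous_on_subset[OF cont(2)])
      then have "(LINT s:{a..t}|lebesgue. f s (y s, y (s - 1)) - f s (x s, x (s - 1))) =
          (LINT s:{a..t}|lebesgue. f s (y s, y (s - 1))) - (LINT s:{a..t}|lebesgue. f s (x s, x (s - 1)))"
        by (intro set_integral_diff(2) set_integrable_delay_self[OF f _ order_refl])
      moreover have "x t = x a + (LINT s:{a..t}|lebesgue. f s (x s, x (s - 1)))"
        "y t = y a + (LINT s:{a..t}|lebesgue. f s (y s, y (s - 1)))"
        using t by (auto intro!: solves_on_eq[OF x'] solves_on_eq[OF y'])
      moreover have "x a = y a"
        using IH[of a] ab by simp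
      ultimately have "y t - x t = (LINT s:{a..t}|lebesgue. f s (y s, y (s - 1)) - f s (x s, x (s - 1)))"
        by simp
      then show ?thesis by simp
    qed
    have "\<forall>s \<in> {a-1..b}. norm (y s - x s) \<le> 2 * 0"
      by (rule \<rho>(2)[THEN spec[of _ a], THEN spec[of _ b], THEN spec[of _ 0], THEN spec[of _ x],
          THEN spec[of _ y], THEN mp]) (use ab cont c IH diff in auto)
    then have "\<And>s. s \<in> {a-1..b} \<Longrightarrow> x s = y s"
      by simp
    then have "x s = y s" if "s \<in> {-1..b}" for s
      using IH[of s] that by (cases "s \<le> a") auto
    then show ?case
      by (simp add: b_def)
  qed
  obtain k where "T < real k * (\<rho> / 2)"
    using ex_less_of_nat_mult[of "\<rho> / 2" T] \<rho>(1) by auto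
  then show ?thesis
    using agree[of k] t by auto
qed

text \<open>The half-open, possibly infinite domain is exhausted by intervals \<open>{-1..T}\<close>
  with \<open>T\<close> below \<open>b\<close>, where restricting and gluing are available.
  Continuity at \<open>t\<close> is local: any \<open>T\<close> strictly between \<open>t\<close>
  and \<open>b\<close> decides it.\<close>

lemma caratheodory_solution_iff:
  fixes f :: "('n::finite) delay_rhs"
  assumes f: "f \<in> LC 1"
  shows "caratheodory_solution f \<phi> b x \<longleftrightarrow> 0 < b \<and> (\<forall>t \<in> {-1..0}. x t = \<phi> t) \<and>
    (\<forall>T. 0 \<le> T \<and> ereal T < b \<longrightarrow> solves_on f 0 T x)"
proof
  assume car: "caratheodory_solution f \<phi> b x"
  then have 0: "x 0 = \<phi> 0"
    by (simp add: caratheodory_solution_def)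
  have "solves_on f 0 T x" if T: "0 \<le> T" "ereal T < b" for T
  proof (rule solves_onI)
    have cont: "continuous_on {t. -1 \<le> t \<and> ereal t < b} x"
      using car unfolding caratheodory_solution_def by blast
    have "ereal t < b" if "t \<le> T" for t
      using that T by (meson ereal_less_eq(3) order_le_less_trans)
    then show "continuous_on {0-1..T} x"
      by (intro continuous_on_subset[OF cont]) auto
    fix t assume "t \<in> {0..T}"
    then have "0 \<le> t \<and> ereal t < b"
      using T by (auto intro: order_le_less_trans[of _ "ereal T"])
    then have "x t = \<phi> 0 + (LINT s:{0..t}|lebesgue. f s (x s, x (s - 1)))"
      using car unfolding caratheodory_solution_def by blast
    with 0 show "x t = x 0 + (LINT s:{0..t}|lebesgue. f s (x s, x (s - 1)))"
      by simp
  qed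
  then show "0 < b \<and> (\<forall>t \<in> {-1..0}. x t = \<phi> t) \<and> (\<forall>T. 0 \<le> T \<and> ereal T < b \<longrightarrow> solves_on f 0 T x)"
    using car unfolding caratheodory_solution_def by blast
next
  assume *: "0 < b \<and> (\<forall>t \<in> {-1..0}. x t = \<phi> t) \<and> (\<forall>T. 0 \<le> T \<and> ereal T < b \<longrightarrow> solves_on f 0 T x)"
  have "continuous (at t within {t. -1 \<le> t \<and> ereal t < b}) x" if t: "-1 \<le> t" "ereal t < b" for t
  proof -
    have "ereal (max t 0) < b"
      using t * by (auto simp: max_def zero_ereal_def)
    then obtain T where T: "ereal (max t 0) < ereal T" "ereal T < b"
      using ereal_dense2 by blast
    then have "continuous_on {-1..T} x"
      using * solves_on_continuous[of f 0 T x] by auto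
    then have "continuous (at t within {-1..T}) x"
      using t T by (auto simp: continuous_on_eq_continuous_within)
    moreover have "at t within {-1..T} = at t within {t. -1 \<le> t \<and> ereal t < b}"
    proof (rule at_within_nhd[of _ "{..<T}"])
      show "{-1..T} \<inter> {..<T} - {t} = {t. -1 \<le> t \<and> ereal t < b} \<inter> {..<T} - {t}"
        using T(2) by (auto intro: order_less_trans[of _ "ereal T"])
    qed (use T in auto)
    ultimately show ?thesis by simp
  qed
  then have "continuous_on {t. -1 \<le> t \<and> ereal t < b} x"
    unfolding continuous_on_eq_continuous_within by blast
  moreover have "set_integrable lebesgue {0..t} (\<lambda>s. f s (x s, x (s - 1))) \<and>
      x t = \<phi> 0 + (LINT s:{0..t}|lebesgue. f s (x s, x (s - 1)))" if t: "0 \<le> t" "ereal t < b" for t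
  proof -
    have x: "solves_on f 0 t x"
      using * t by blast
    have "x 0 = \<phi> 0"
      using * by simp
    then show ?thesis
      using set_integrable_delay_self[OF f solves_on_continuous[OF x] order_refl]
        solves_on_eq[OF x t(1) order_refl] by simp
  qed
  ultimately show "caratheodory_solution f \<phi> b x"
    using * unfolding caratheodory_solution_def by blast
qed

lemma caratheodory_solution_unique:
  fixes f :: "('n::finite) delay_rhs"
  assumes f: "f \<in> LC 1" and x: "caratheodory_solution f \<phi> b x" and y: "caratheodory_solution f \<phi> b' y"
    and t: "-1 \<le> t" "ereal t < b" "ereal t < b'"
  shows "x t = y t"
proof (rule solves_on_unique[OF f])
  have "ereal (max t 0) < b" "ereal (max t 0) < b'"
    using x y t by (auto simp: max_def caratheodory_solution_def zero_ereal_def)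
  then show "solves_on f 0 (max t 0) x" "solves_on f 0 (max t 0) y"
    using x y by (auto simp: caratheodory_solution_iff[OF f])
  show "x s = y s" if "s \<in> {-1..0}" for s
    using x y that by (auto simp: caratheodory_solution_def)
qed (use t in auto)

text \<open>Solutions agree wherever two of them are defined, so together they form one solution;
  its end is the supremum of all ends and cannot be exceeded. Local existence at time
  \<open>0\<close> provides a first solution.\<close>

lemma maximal_solution_exists:
  fixes f :: "('n::finite) delay_rhs"
  assumes f: "f \<in> LC 1" and \<phi>: "continuous_on {-1..0} \<phi>"
  shows "\<exists>b x. maximal_solution f \<phi> b x"
proof -
  define S where "S = {b. \<exists>y. caratheodory_solution f \<phi> b y}"
  \<comment> \<open>By uniqueness every solution still alive at \<open>t\<close> offers the same
    value, so the choice is immaterial there.\<close>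
  define x where "x t = (SOME v. \<exists>b y. caratheodory_solution f \<phi> b y \<and> ereal t < b \<and> v = y t)" for t
  have x: "x t = y t" if "caratheodory_solution f \<phi> b y" "-1 \<le> t" "ereal t < b" for t b y
  proof -
    have "\<exists>b' y'. caratheodory_solution f \<phi> b' y' \<and> ereal t < b' \<and> x t = y' t"
      unfolding x_def by (rule someI_ex) (use that in blast)
    then show ?thesis
      using caratheodory_solution_unique[OF f] that by metis
  qed
  have "bounded (\<phi> ` {-1..0})"
    using \<phi> by (simp add: compact_imp_bounded compact_continuous_image)
  then obtain c where c: "\<And>s. s \<in> {-1..0} \<Longrightarrow> norm (\<phi> s) \<le> c"
    unfolding bounded_iff by blast
  obtain h where h: "h > 0" "\<forall>a x. 0 \<le> a \<and> a \<le> 0 \<and> continuous_on {a-1..a} x \<and> (\<forall>s \<in> {a-1..a}. norm (x s) \<le> c) \<longrightarrow>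
      (\<exists>y. solves_on f a (a + h) y \<and> (\<forall>s \<in> {a-1..a}. y s = x s))"
    using local_existence[OF f, of 0 c] by blast
  have "\<exists>y. solves_on f 0 (0 + h) y \<and> (\<forall>s \<in> {0-1..0}. y s = \<phi> s)"
    by (rule h(2)[rule_format]) (use \<phi> c in auto)
  then obtain y where y: "solves_on f 0 h y" "\<forall>s \<in> {-1..0}. y s = \<phi> s"
    by auto
  have "caratheodory_solution f \<phi> (ereal h) y"
    unfolding caratheodory_solution_iff[OF f]
    using y h(1) solves_on_subinterval[OF f y(1)] by (auto simp: zero_ereal_def)
  then have hS: "ereal h \<in> S"
    by (auto simp: S_def)
  have "caratheodory_solution f \<phi> (Sup S) x"
    unfolding caratheodory_solution_iff[OF f]
  proof (intro conjI ballI allI impI)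
    show "0 < Sup S"
      using h(1) by (intro less_le_trans[OF _ Sup_upper[OF hS]]) simp
    show "x t = \<phi> t" if "t \<in> {-1..0}" for t
      using x[OF \<open>caratheodory_solution f \<phi> (ereal h) y\<close>, of t] y(2) h(1) that by auto
    fix T assume T: "0 \<le> T \<and> ereal T < Sup S"
    then obtain b z where z: "caratheodory_solution f \<phi> b z" "ereal T < b"
      by (auto simp: less_Sup_iff S_def)
    show "solves_on f 0 T x"
    proof (rule solves_on_cong)
      show "solves_on f 0 T z"
        using z T by (simp add: caratheodory_solution_iff[OF f])
      show "z t = x t" if "t \<in> {0-1..T}" for t
      proof (rule x[OF z(1), symmetric])
        show "ereal t < b"
          using that z(2) by (auto intro: order_le_less_trans[of _ "ereal T"])
      qed (use that in auto)
    qed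
  qed
  then have "maximal_solution f \<phi> (Sup S) x"
    unfolding maximal_solution_def by (auto simp: S_def intro: Sup_upper)
  then show ?thesis by blast
qed

text \<open>If one end were larger, uniqueness would make the longer solution a proper extension of
  the shorter one, against maximality.\<close>

lemma maximal_solution_end_unique:
  fixes f :: "('n::finite) delay_rhs"
  assumes f: "f \<in> LC 1" and x: "maximal_solution f \<phi> b x" and y: "maximal_solution f \<phi> b' y"
  shows "b = b'"
proof (rule antisym)
  have *: "d \<le> b" if x: "maximal_solution f \<phi> b x" and y: "maximal_solution f \<phi> d y"
    for b d and x y :: "real \<Rightarrow> real ^ 'n"
  proof (rule ccontr)
    assume "\<not> d \<le> b"
    then have "b < d" by simp
    have "y t = x t" if "-1 \<le> t" "ereal t < b" for t
      using x y that order_less_trans[OF that(2) \<open>b < d\<close>]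
      by (intro caratheodory_solution_unique[OF f, of \<phi> d y b x]) (auto simp: maximal_solution_def)
    then have "d \<le> b"
      using x y unfolding maximal_solution_def by blast
    with \<open>b < d\<close> show False by simp
  qed
  show "b \<le> b'" "b' \<le> b"
    using *[OF y x] *[OF x y] .
qed

text \<open>Discharges the \<open>THE\<close> in \<open>sol_end\<close> and the \<open>SOME\<close>
  in \<open>sol\<close>; later arguments reach the chosen solution only through this fact.\<close>

lemma maximal_solution_sol:
  fixes f :: "('n::finite) delay_rhs"
  assumes f: "f \<in> LC 1" and \<phi>: "continuous_on {-1..0} \<phi>"
  shows "maximal_solution f \<phi> (sol_end f \<phi>) (sol f \<phi>)"
proof -
  have "\<exists>x. maximal_solution f \<phi> (sol_end f \<phi>) x"
    unfolding sol_end_def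
    by (rule theI') (use maximal_solution_exists[OF f \<phi>] maximal_solution_end_unique[OF f] in blast)
  then show ?thesis
    unfolding sol_def by (rule someI_ex)
qed

lemma sol_end_pos:
  fixes f :: "('n::finite) delay_rhs"
  assumes "f \<in> LC 1" "continuous_on {-1..0} \<phi>"
  shows "0 < sol_end f \<phi>"
  using maximal_solution_sol[OF assms] by (simp add: maximal_solution_def caratheodory_solution_def)

lemma sol_initial:
  fixes f :: "('n::finite) delay_rhs"
  assumes "f \<in> LC 1" "continuous_on {-1..0} \<phi>" "t \<in> {-1..0}"
  shows "sol f \<phi> t = \<phi> t"
  using maximal_solution_sol[OF assms(1,2)] assms(3)
  by (simp add: maximal_solution_def caratheodory_solution_def)

lemma solves_on_sol:
  fixes f :: "('n::finite) delay_rhs"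
  assumes "f \<in> LC 1" "continuous_on {-1..0} \<phi>" "0 \<le> T" "ereal T < sol_end f \<phi>"
  shows "solves_on f 0 T (sol f \<phi>)"
  using maximal_solution_sol[OF assms(1,2)] assms(3,4)
  by (simp add: maximal_solution_def caratheodory_solution_iff[OF assms(1)])

text \<open>A solution bounded by \<open>c\<close> up to a finite end could be restarted within
  \<open>h / 2\<close> of that end and would outlive it. Unboundedness in this form is what
  contradicts closeness to a bounded limit solution.\<close>

lemma sol_blow_up:
  fixes f :: "('n::finite) delay_rhs"
  assumes f: "f \<in> LC 1" and \<phi>: "continuous_on {-1..0} \<phi>" and fin: "sol_end f \<phi> \<le> ereal r"
  shows "\<exists>t. -1 \<le> t \<and> ereal t < sol_end f \<phi> \<and> c < norm (sol f \<phi> t)"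
proof (rule ccontr)
  assume "\<not> ?thesis"
  then have c: "norm (sol f \<phi> t) \<le> c" if "-1 \<le> t" "ereal t < sol_end f \<phi>" for t
    using that by force
  obtain b where b: "sol_end f \<phi> = ereal b"
    using sol_end_pos[OF f \<phi>] fin by (cases "sol_end f \<phi>") auto
  then have br: "0 < b" "b \<le> r"
    using sol_end_pos[OF f \<phi>] fin by auto
  obtain h where h: "h > 0" "\<forall>a x. 0 \<le> a \<and> a \<le> r \<and> continuous_on {a-1..a} x \<and> (\<forall>s \<in> {a-1..a}. norm (x s) \<le> c) \<longrightarrow>
      (\<exists>y. solves_on f a (a + h) y \<and> (\<forall>s \<in> {a-1..a}. y s = x s))"
    using local_existence[OF f, of r c] by blast
  \<comment> \<open>Restarting is allowed from time \<open>0\<close> on. If the maximum is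
    \<open>0\<close>, then \<open>b \<le> h / 2\<close>, and \<open>a + h\<close> still exceeds
    \<open>b\<close>.\<close>
  define a where "a = max 0 (b - h / 2)"
  have a: "0 \<le> a" "a < b" "b < a + h"
    using br h(1) by (auto simp: a_def max_def)
  have x: "solves_on f 0 a (sol f \<phi>)"
    using a by (intro solves_on_sol[OF f \<phi>]) (auto simp: b)
  have "\<exists>y. solves_on f a (a + h) y \<and> (\<forall>s \<in> {a-1..a}. y s = sol f \<phi> s)"
  proof (rule h(2)[rule_format], intro conjI ballI)
    show "continuous_on {a-1..a} (sol f \<phi>)"
      using a by (intro continuous_on_subset[OF solves_on_continuous[OF x]]) auto
    show "norm (sol f \<phi> s) \<le> c" if "s \<in> {a-1..a}" for s
      using that a by (intro c) (auto simp: b)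
  qed (use a br in auto)
  then obtain y where y: "solves_on f a (a + h) y" "\<forall>s \<in> {a-1..a}. y s = sol f \<phi> s"
    by blast
  define z where "z t = (if t \<le> a then sol f \<phi> t else y t)" for t
  have "solves_on f 0 a z"
    by (rule solves_on_cong[OF x]) (auto simp: z_def)
  moreover have "solves_on f a (a + h) z"
    by (rule solves_on_cong[OF y(1)]) (use y(2) in \<open>auto simp: z_def\<close>)
  ultimately have "solves_on f 0 (a + h) z"
    by (rule solves_on_join[OF f]) (use a h in auto)
  then have z: "caratheodory_solution f \<phi> (ereal (a + h)) z"
    unfolding caratheodory_solution_iff[OF f]
    using a h(1) solves_on_subinterval[OF f, of 0 "a + h" z] sol_initial[OF f \<phi>]
    by (auto simp: z_def zero_ereal_def)
  have max: "maximal_solution f \<phi> (ereal b) (sol f \<phi>)"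
    using maximal_solution_sol[OF f \<phi>] by (simp add: b)
  then have "z t = sol f \<phi> t" if "-1 \<le> t" "ereal t < ereal b" for t
    using that a by (intro caratheodory_solution_unique[OF f z]) (auto simp: maximal_solution_def)
  then have "ereal (a + h) \<le> ereal b"
    using max z unfolding maximal_solution_def by blast
  with a show False by simp
qed

subsection \<open>Convergence along solutions\<close>

text \<open>All generating sets lie in \<open>X\<close>, hence so does the limit. \<open>S\<close>
  is an arbitrary set of real functions, so that \<open>f\<close> lies in its own ball has to be
  supplied as \<open>s (f - f) = 0\<close>.\<close>

lemma limitin_seminorm_topology:
  assumes lim: "limitin (seminorm_topology X S) fs f sequentially"
  shows "f \<in> X"
    and "s \<in> S \<Longrightarrow> s (f - f) = 0 \<Longrightarrow> 0 < \<epsilon> \<Longrightarrow> \<forall>\<^sub>F n in sequentially. s (fs n - f) < \<epsilon>"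
proof -
  show f: "f \<in> X"
    using limitin_topspace[OF lim] by (auto simp: seminorm_topology_def)
  assume s: "s \<in> S" "s (f - f) = 0" "0 < \<epsilon>"
  have "openin (seminorm_topology X S) {g \<in> X. s (g - f) < \<epsilon>}"
    unfolding seminorm_topology_def by (rule topology_generated_by_Basis) (use f s in blast)
  moreover have "f \<in> {g \<in> X. s (g - f) < \<epsilon>}"
    using f s by simp
  ultimately have "\<forall>\<^sub>F n in sequentially. fs n \<in> {g \<in> X. s (g - f) < \<epsilon>}"
    using lim unfolding limitin_def by blast
  then show "\<forall>\<^sub>F n in sequentially. s (fs n - f) < \<epsilon>"
    by eventually_elim simp
qed

section \<open>The seminorms as genuine suprema\<close>

text \<open>The supremum of an empty set of reals carries no information, so nonempty index sets are
  needed to evaluate a seminorm at \<open>0\<close>. The zero curve qualifies because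
  \<open>enn2real\<close> makes every modulus nonnegative.\<close>

lemma zero_in_K_set: "(\<lambda>_. 0) \<in> K_set (m_bounds_moduli E) a b j"
  by (auto simp: K_set_def C_ball_def m_bounds_moduli_def)

lemma zero_in_C_ball: "(\<lambda>_. 0) \<in> C_ball a b j"
  by (auto simp: C_ball_def)

lemma seminorm_ThetaB_zero:
  fixes f :: "('n::finite) delay_rhs"
  assumes "1 \<le> p"
  shows "seminorm_ThetaB p (m_bounds_moduli E) a b j (f - f) = 0"
proof -
  have "K_set (m_bounds_moduli E) a b j \<times> C_ball (a - 1) (b - 1) j \<noteq> ({} :: ((real \<Rightarrow> real ^ 'n) \<times> (real \<Rightarrow> real ^ 'n)) set)"
    using zero_in_K_set zero_in_C_ball by blast
  then show ?thesis
    using assms unfolding seminorm_ThetaB_def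
    by (simp add: case_prod_unfold power_0_left set_lebesgue_integral_def)
qed

lemma seminorm_ThetaD_zero:
  fixes f :: "('n::finite) delay_rhs"
  shows "seminorm_ThetaD (m_bounds_moduli E) a b j u (f - f) = 0"
proof -
  have "K_set (m_bounds_moduli E) a b j \<noteq> ({} :: (real \<Rightarrow> real ^ 'n) set)"
    using zero_in_K_set by blast
  then show ?thesis
    unfolding seminorm_ThetaD_def by (simp add: set_lebesgue_integral_def)
qed

text \<open>A real supremum bounds its members only if they are bounded above. All pairs
  \<open>(x t, u (t - 1))\<close> lie in the ball of radius \<open>2 * real j\<close>, where one
  function of \<open>Lp_loc p\<close> dominates \<open>F\<close>; it also gives integrability, so
  the integral is not a default value.\<close>

lemma seminorm_ThetaB_upper:
  fixes F :: "('n::finite) delay_rhs"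
  assumes F: "F \<in> LC p" and p: "1 \<le> p"
    and x: "x \<in> K_set \<theta> a b j" and u: "u \<in> C_ball (a - 1) (b - 1) j"
  shows "set_integrable lebesgue {a..b} (\<lambda>t. norm (F t (x t, u (t - 1))) ^ p)"
    and "root p (LINT t:{a..b}|lebesgue. norm (F t (x t, u (t - 1))) ^ p) \<le> seminorm_ThetaB p \<theta> a b j F"
proof -
  obtain m l where m: "m \<in> Lp_loc p" and "AE t in lebesgue. (\<forall>z \<in> cball 0 (2 * real j). norm (F t z) \<le> m t) \<and>
      (\<forall>z1 \<in> cball 0 (2 * real j). \<forall>z2 \<in> cball 0 (2 * real j). norm (F t z1 - F t z2) \<le> l t * norm (z1 - z2))"
    using F compact_cball unfolding LC_def by blast
  then have ae: "AE t in lebesgue. \<forall>z \<in> cball 0 (2 * real j). norm (F t z) \<le> m t"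
    by auto
  have mp: "set_integrable lebesgue {a..b} (\<lambda>t. \<bar>m t\<bar> ^ p)"
    using m by (auto simp: Lp_loc_def)
  have *: "set_integrable lebesgue {a..b} (\<lambda>t. norm (F t (x t, u (t - 1))) ^ p) \<and>
      (LINT t:{a..b}|lebesgue. norm (F t (x t, u (t - 1))) ^ p) \<le> (LINT t:{a..b}|lebesgue. \<bar>m t\<bar> ^ p)"
    if x: "x \<in> K_set \<theta> a b j" and u: "u \<in> C_ball (a - 1) (b - 1) j" for x u
  proof -
    have xc: "continuous_on {a..b} x" and uc: "continuous_on {a-1..b-1} u"
      and xb: "\<And>t. t \<in> {a..b} \<Longrightarrow> norm (x t) \<le> j" and ub: "\<And>t. t \<in> {a-1..b-1} \<Longrightarrow> norm (u t) \<le> j"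
      using x u by (auto simp: K_set_def C_ball_def image_subset_iff)
    have "AE t in lebesgue. t \<in> {a..b} \<longrightarrow> norm (F t (x t, u (t - 1))) ^ p \<le> \<bar>m t\<bar> ^ p"
      using ae
    proof eventually_elim
      case (elim t)
      show ?case
      proof
        assume t: "t \<in> {a..b}"
        then have "norm (x t, u (t - 1)) \<le> 2 * real j"
          using norm_Pair_le[of "x t" "u (t - 1)"] xb[of t] ub[of "t - 1"] by simp
        then have "norm (F t (x t, u (t - 1))) \<le> m t"
          using elim by simp
        then show "norm (F t (x t, u (t - 1))) ^ p \<le> \<bar>m t\<bar> ^ p"
          by (intro power_mono) auto
      qed
    qed
    note ae' = this
    have "set_borel_measurable lebesgue {a..b} (\<lambda>t. F t (x t, u (t - 1)))"
      by (intro set_borel_measurable_rhs[OF F] set_borel_measurable_lebesgue_continuous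
          continuous_on_delay_pair xc uc)
    then have "(\<lambda>t. norm (indicator {a..b} t *\<^sub>R F t (x t, u (t - 1))) ^ p) \<in> borel_measurable lebesgue"
      unfolding set_borel_measurable_def by measurable
    also have "(\<lambda>t. norm (indicator {a..b} t *\<^sub>R F t (x t, u (t - 1))) ^ p) =
        (\<lambda>t. indicator {a..b} t *\<^sub>R (norm (F t (x t, u (t - 1))) ^ p))"
      using p by (auto simp: indicator_def power_0_left)
    finally have meas: "set_borel_measurable lebesgue {a..b} (\<lambda>t. norm (F t (x t, u (t - 1))) ^ p)"
      by (simp add: set_borel_measurable_def)
    have "AE t in lebesgue. t \<in> {a..b} \<longrightarrow>
        norm (norm (F t (x t, u (t - 1))) ^ p) \<le> norm (\<bar>m t\<bar> ^ p)"
      using ae' by eventually_elim simp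
    from set_integrable_bound[OF mp meas this]
    have int: "set_integrable lebesgue {a..b} (\<lambda>t. norm (F t (x t, u (t - 1))) ^ p)" .
    then show ?thesis
      using set_integral_mono_AE[OF int mp ae'] by blast
  qed
  show "set_integrable lebesgue {a..b} (\<lambda>t. norm (F t (x t, u (t - 1))) ^ p)"
    using *[OF x u] by blast
  have "bdd_above ((\<lambda>(x, u). root p (LINT t:{a..b}|lebesgue. norm (F t (x t, u (t - 1))) ^ p)) `
      (K_set \<theta> a b j \<times> C_ball (a - 1) (b - 1) j))"
    by (rule bdd_aboveI[of _ "root p (LINT t:{a..b}|lebesgue. \<bar>m t\<bar> ^ p)"])
      (use * p in \<open>auto intro!: real_root_le_mono\<close>)
  from cSUP_upper[OF _ this, of "(x, u)"] x u
  show "root p (LINT t:{a..b}|lebesgue. norm (F t (x t, u (t - 1))) ^ p) \<le> seminorm_ThetaB p \<theta> a b j F"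
    by (simp add: seminorm_ThetaB_def)
qed

text \<open>Boundedness of the supremum again, now from the integrable bound of \<open>F\<close> on
  a ball containing all \<open>(x t, u)\<close> for the fixed \<open>u\<close>.\<close>

lemma seminorm_ThetaD_upper:
  fixes F :: "('n::finite) delay_rhs"
  assumes F: "F \<in> LC 1" and x: "x \<in> K_set \<theta> a b j"
  shows "norm (LINT t:{a..b}|lebesgue. F t (x t, u)) \<le> seminorm_ThetaD \<theta> a b j u F"
proof -
  define R where "R = real j + norm u"
  obtain m l where ml: "\<And>a b. set_integrable lebesgue {a..b} m" "\<And>a b. set_integrable lebesgue {a..b} l"
    "\<And>t. 0 \<le> m t" "\<And>t. 0 \<le> l t"
    "AE t in lebesgue. (\<forall>z \<in> cball 0 R. norm (F t z) \<le> m t) \<and>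
      (\<forall>z1 \<in> cball 0 R. \<forall>z2 \<in> cball 0 R. norm (F t z1 - F t z2) \<le> l t * norm (z1 - z2))"
    by (rule LC1_bounds[OF F that])
  have "norm (LINT t:{a..b}|lebesgue. F t (x t, u)) \<le> (LINT t:{a..b}|lebesgue. m t)"
    if x: "x \<in> K_set \<theta> a b j" for x
  proof (rule norm_set_integral_le[OF _ ml(1)])
    have xc: "continuous_on {a..b} x" and xb: "\<And>t. t \<in> {a..b} \<Longrightarrow> norm (x t) \<le> j"
      using x by (auto simp: K_set_def C_ball_def image_subset_iff)
    show "set_integrable lebesgue {a..b} (\<lambda>t. F t (x t, u))"
      using set_integrable_delay[OF F xc, of "\<lambda>_. u"] by simp
    show "AE t in lebesgue. t \<in> {a..b} \<longrightarrow> norm (F t (x t, u)) \<le> m t"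
      using ml(5)
    proof eventually_elim
      case (elim t)
      show ?case
      proof
        assume "t \<in> {a..b}"
        then have "norm (x t, u) \<le> R"
          using norm_Pair_le[of "x t" u] xb[of t] by (simp add: R_def)
        then show "norm (F t (x t, u)) \<le> m t"
          using elim by simp
      qed
    qed
  qed
  then have "bdd_above ((\<lambda>x. norm (LINT t:{a..b}|lebesgue. F t (x t, u))) ` K_set \<theta> a b j)"
    by (intro bdd_aboveI2)
  from cSUP_upper[OF x this] show ?thesis
    by (simp add: seminorm_ThetaD_def)
qed

section \<open>Solutions inherit the modulus given by the m-bounds\<close>

lemma norm_integral_le_m_bound:
  fixes g :: "('n::finite) delay_rhs"
  assumes "set_integrable lebesgue S (\<lambda>s. g s (z s))" and "\<And>s. s \<in> S \<Longrightarrow> norm (z s) \<le> real J"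
  shows "ennreal (norm (LINT s:S|lebesgue. g s (z s))) \<le> (\<integral>\<^sup>+s\<in>S. m_bound g J s \<partial>lebesgue)"
proof (rule norm_set_integral_le_nn_integral[OF assms(1)])
  fix s assume "s \<in> S"
  then show "ennreal (norm (g s (z s))) \<le> m_bound g J s"
    unfolding m_bound_def using assms(2) by (intro SUP_upper) simp
qed

lemma set_nn_integral_mono_set:
  assumes "A \<subseteq> B"
  shows "(\<integral>\<^sup>+s\<in>A. w s \<partial>M) \<le> (\<integral>\<^sup>+s\<in>B. w s \<partial>M)"
  using assms by (intro nn_integral_mono) (auto split: split_indicator)

text \<open>On short intervals equicontinuity bounds the supremum behind \<^const>\<open>m_bounds_moduli\<close>, so that
  \<^const>\<open>enn2real\<close> does not collapse it to \<open>0\<close>. The index is \<open>2 * j + 2\<close> because both components of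
  \<open>(y s, y (s - 1))\<close> may have norm \<open>j + 1\<close>. Freezing \<open>y\<close> after \<open>\<tau>\<close> keeps its modulus.\<close>

lemma solution_in_K_set:
  fixes E :: "('n::finite) delay_rhs set"
  assumes equi: "L1loc_equicontinuous_m_bounds E" and E: "E \<subseteq> LC 1"
  shows "\<exists>\<rho>>0. \<forall>g a b \<tau> y. g \<in> E \<and> 0 \<le> a \<and> a \<le> \<tau> \<and> \<tau> \<le> b \<and> b \<le> r \<and> b - a < \<rho> \<and> solves_on g a \<tau> y \<and>
      (\<forall>s \<in> {a-1..\<tau>}. norm (y s) \<le> real j + 1) \<longrightarrow>
      (\<lambda>t. y (min t \<tau>)) \<in> K_set (m_bounds_moduli E) a b (2 * j + 2)"
proof (cases "r < 0")
  case True
  then show ?thesis by (intro exI[of _ 1]) auto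
next
  case False
  define J where "J = 2 * j + 2"
  \<comment> \<open>The modulus at \<open>v \<in> {a..b}\<close> looks ahead to
    \<open>v + (t - s)\<close>, which may pass \<open>b\<close> by less than \<open>1\<close>. Hence
    equicontinuity is used on radius \<open>r + 1\<close> and interval lengths stay below
    \<open>min \<delta> 1\<close>.\<close>
  obtain \<delta> where \<delta>: "\<delta> > 0" "\<And>s t. - (r + 1) \<le> s \<Longrightarrow> s \<le> t \<Longrightarrow> t \<le> r + 1 \<Longrightarrow> t - s < \<delta> \<Longrightarrow>
      (SUP f \<in> E. \<integral>\<^sup>+\<tau>\<in>{s..t}. m_bound f J \<tau> \<partial>lebesgue) < ennreal 1"
  proof -
    have "0 < r + 1" using False by simp
    then have "\<exists>\<delta>>0. \<forall>s t. - (r + 1) \<le> s \<and> s \<le> t \<and> t \<le> r + 1 \<and> t - s < \<delta> \<longrightarrow>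
        (SUP f \<in> E. \<integral>\<^sup>+\<tau>\<in>{s..t}. m_bound f J \<tau> \<partial>lebesgue) < ennreal 1"
      using equi zero_less_one unfolding L1loc_equicontinuous_m_bounds_def by blast
    then show thesis using that by blast
  qed
  have "(\<lambda>t. y (min t \<tau>)) \<in> K_set (m_bounds_moduli E) a b J"
    if g: "g \<in> E" and le: "0 \<le> a" "a \<le> \<tau>" "\<tau> \<le> b" "b \<le> r" "b - a < min \<delta> 1" and y: "solves_on g a \<tau> y"
      and yb: "\<forall>s \<in> {a-1..\<tau>}. norm (y s) \<le> real j + 1"
    for g a b \<tau> and y :: "real \<Rightarrow> real ^ 'n"
  proof -
    have yc: "continuous_on {a-1..\<tau>} y"
      by (rule solves_on_continuous[OF y])
    have ball: "norm (y s, y (s - 1)) \<le> real J" if "s \<in> {a..\<tau>}" for s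
      unfolding J_def using yb that by (intro norm_Pair_le_ball) auto
    have mod: "norm (y (min t \<tau>) - y (min s \<tau>)) \<le> m_bounds_moduli E a b J (t - s)"
      if st: "a \<le> s" "s \<le> t" "t \<le> b" for s t
    proof -
      \<comment> \<open>Truncation at \<tau> does not increase distances, so \<open>{s'..t'}\<close>
        fits into the window of length \<open>t - s\<close> starting at \<open>s'\<close>, one of
        those in the supremum.\<close>
      define s' t' where "s' = min s \<tau>" and "t' = min t \<tau>"
      have st': "a \<le> s'" "s' \<le> t'" "t' \<le> \<tau>" "t' \<le> s' + (t - s)"
        using st le by (auto simp: s'_def t'_def)
      have y': "solves_on g s' t' y"
        using solves_on_subinterval[OF _ y] g E st' by blast
      have "set_integrable lebesgue {s'..t'} (\<lambda>s. g s (y s, y (s - 1)))"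
        using g E by (intro set_integrable_delay_self[OF _ solves_on_continuous[OF y']]) auto
      then have "ennreal (norm (LINT s:{s'..t'}|lebesgue. g s (y s, y (s - 1))))
          \<le> (\<integral>\<^sup>+s\<in>{s'..t'}. m_bound g J s \<partial>lebesgue)"
        by (rule norm_integral_le_m_bound) (use ball st' in auto)
      also have "(LINT s:{s'..t'}|lebesgue. g s (y s, y (s - 1))) = y t' - y s'"
        using solves_on_eq[OF y', of t'] st' by simp
      also have "(\<integral>\<^sup>+s\<in>{s'..t'}. m_bound g J s \<partial>lebesgue) \<le> (\<integral>\<^sup>+s\<in>{s'..s' + (t - s)}. m_bound g J s \<partial>lebesgue)"
        using st' by (intro set_nn_integral_mono_set) auto
      also have "\<dots> \<le> (SUP (v, f) \<in> {a..b} \<times> E. \<integral>\<^sup>+s\<in>{v..v + (t - s)}. m_bound f J s \<partial>lebesgue)"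
        using g st' le by (intro SUP_upper2[of "(s', g)"]) auto
      finally have 1: "ennreal (norm (y t' - y s')) \<le>
          (SUP (v, f) \<in> {a..b} \<times> E. \<integral>\<^sup>+s\<in>{v..v + (t - s)}. m_bound f J s \<partial>lebesgue)" .
      have "(SUP (v, f) \<in> {a..b} \<times> E. \<integral>\<^sup>+s\<in>{v..v + (t - s)}. m_bound f J s \<partial>lebesgue) \<le> ennreal 1"
      proof (rule SUP_least)
        fix w assume w: "w \<in> {a..b} \<times> E"
        obtain v f where vf: "w = (v, f)" by (cases w)
        have "(\<integral>\<^sup>+s\<in>{v..v + (t - s)}. m_bound f J s \<partial>lebesgue)
            \<le> (SUP f \<in> E. \<integral>\<^sup>+s\<in>{v..v + (t - s)}. m_bound f J s \<partial>lebesgue)"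
          using w by (intro SUP_upper) (simp add: vf)
        also have "\<dots> < ennreal 1"
          using w st le by (intro \<delta>(2)) (auto simp: vf)
        finally show "(case w of (v, f) \<Rightarrow> \<integral>\<^sup>+s\<in>{v..v + (t - s)}. m_bound f J s \<partial>lebesgue) \<le> ennreal 1"
          by (simp add: vf)
      qed
      then have "(SUP (v, f) \<in> {a..b} \<times> E. \<integral>\<^sup>+s\<in>{v..v + (t - s)}. m_bound f J s \<partial>lebesgue) < top"
        by (rule le_less_trans) simp
      then have "norm (y t' - y s') \<le> m_bounds_moduli E a b J (t - s)"
        using enn2real_mono[OF 1] by (simp add: m_bounds_moduli_def)
      then show ?thesis
        by (simp add: s'_def t'_def)
    qed
    have "norm (y (min t \<tau>) - y (min s \<tau>)) \<le> m_bounds_moduli E a b J \<bar>t - s\<bar>"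
      if "t \<in> {a..b}" "s \<in> {a..b}" for s t
      using mod[of s t] mod[of t s] that by (cases "s \<le> t") (auto simp: norm_minus_commute)
    moreover have "continuous_on {a..b} (\<lambda>t. y (min t \<tau>))"
      using le by (intro continuous_on_compose2[OF yc] continuous_intros) auto
    moreover have "norm (y (min t \<tau>)) \<le> real J" if "t \<in> {a..b}" for t
    proof -
      have "norm (y (min t \<tau>)) \<le> real j + 1"
        using yb le that by auto
      then show ?thesis by (simp add: J_def)
    qed
    ultimately show ?thesis
      by (auto simp: K_set_def C_ball_def)
  qed
  then show ?thesis
    using \<delta>(1) unfolding J_def by (intro exI[of _ "min \<delta> 1"]) auto
qed

text \<open>The only consequence of either convergence \<open>fs \<longrightarrow> f\<close> that the continuity argument uses:
  along solutions of the approximating equations whose past on \<open>[a - 1, a]\<close> is close to a fixed function,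
  the integrals of \<open>fs n - f\<close> tend to \<open>0\<close> uniformly.\<close>

definition converges_along_solutions :: "(nat \<Rightarrow> ('n::finite) delay_rhs) \<Rightarrow> 'n delay_rhs \<Rightarrow> bool" where
  "converges_along_solutions fs f \<longleftrightarrow> (\<forall>j r. \<exists>\<rho>>0. \<forall>a b x \<epsilon>. a \<in> \<rat> \<and> b \<in> \<rat> \<and> 0 \<le> a \<and> a \<le> b \<and> b \<le> r \<and>
     b - a < \<rho> \<and> 0 < \<epsilon> \<and> continuous_on {a-1..a} x \<and> (\<forall>s \<in> {a-1..a}. norm (x s) \<le> real j) \<longrightarrow>
     (\<exists>\<delta>>0. \<forall>\<^sub>F n in sequentially. \<forall>\<tau> y. a \<le> \<tau> \<and> \<tau> \<le> b \<and> solves_on (fs n) a \<tau> y \<and>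
        (\<forall>s \<in> {a-1..\<tau>}. norm (y s) \<le> real j + 1) \<and> (\<forall>s \<in> {a-1..a}. norm (y s - x s) \<le> \<delta>) \<longrightarrow>
        norm (LINT s:{a..\<tau>}|lebesgue. (fs n - f) s (y s, y (s - 1))) \<le> \<epsilon>))"

section \<open>Convergence with the norm under the integral\<close>

text \<open>Takes the role of Hoelder's inequality in passing from \<open>p\<close>-th powers to the
  plain integral: values up to \<eta> are paid by \<eta>, larger ones satisfy
  \<open>\<eta> ^ (p - 1) \<le> v ^ (p - 1)\<close>.\<close>

lemma le_add_power_quotient:
  fixes v \<eta> :: real
  assumes "0 \<le> v" "0 < \<eta>" "1 \<le> p"
  shows "v \<le> \<eta> + v ^ p / \<eta> ^ (p - 1)"
proof (cases "v \<le> \<eta>")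
  case True
  then show ?thesis using assms by (simp add: add_increasing2)
next
  case False
  have "v * \<eta> ^ (p - 1) \<le> v * v ^ (p - 1)"
    using assms False by (intro mult_left_mono power_mono) auto
  also have "\<dots> = v ^ p"
    using assms(3) by (cases p) auto
  finally have "v \<le> v ^ p / \<eta> ^ (p - 1)"
    using assms(2) by (simp add: pos_le_divide_eq)
  then show ?thesis using assms(2) by linarith
qed

text \<open>The seminorm takes a supremum over all continuous delayed arguments in the ball, so the
  solution's own past is one of the competitors; a single seminorm on \<open>{a..b}\<close> then
  serves every \<tau>.\<close>

lemma T_ThetaB_converges_along_solutions:
  fixes E :: "('n::finite) delay_rhs set"
  assumes p: "1 \<le> p" and E: "E \<subseteq> LC p" and equi: "L1loc_equicontinuous_m_bounds E"
    and fs: "\<And>n. fs n \<in> E"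
    and lim: "limitin (T_ThetaB p (m_bounds_moduli E)) fs f sequentially"
  shows "converges_along_solutions fs f"
  unfolding converges_along_solutions_def
proof (intro allI)
  fix j :: nat and r :: real
  define J where "J = 2 * j + 2"
  have f: "f \<in> LC p"
    using limitin_seminorm_topology(1)[OF lim[unfolded T_ThetaB_def]] .
  have E1: "E \<subseteq> LC 1"
    using E LC_subset_LC1[OF p] by blast
  obtain \<rho> where \<rho>: "\<rho> > 0" "\<And>g a b \<tau> y. g \<in> E \<Longrightarrow> 0 \<le> a \<Longrightarrow> a \<le> \<tau> \<Longrightarrow> \<tau> \<le> b \<Longrightarrow> b \<le> r \<Longrightarrow> b - a < \<rho> \<Longrightarrow>
      solves_on g a \<tau> y \<Longrightarrow> (\<forall>s \<in> {a-1..\<tau>}. norm (y s) \<le> real j + 1) \<Longrightarrow>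
      (\<lambda>t. y (min t \<tau>)) \<in> K_set (m_bounds_moduli E) a b J"
    using solution_in_K_set[OF equi E1, of r j] unfolding J_def by blast
  have "\<forall>\<^sub>F n in sequentially. \<forall>\<tau> y. a \<le> \<tau> \<and> \<tau> \<le> b \<and> solves_on (fs n) a \<tau> y \<and>
        (\<forall>s \<in> {a-1..\<tau>}. norm (y s) \<le> real j + 1) \<and> (\<forall>s \<in> {a-1..a}. norm (y s - x s) \<le> 1) \<longrightarrow>
        norm (LINT s:{a..\<tau>}|lebesgue. (fs n - f) s (y s, y (s - 1))) \<le> \<epsilon>"
    if ab: "a \<in> \<rat>" "b \<in> \<rat>" "0 \<le> a" "a \<le> b" "b \<le> r" "b - a < \<rho>" and "0 < \<epsilon>"
    for a b \<epsilon> and x :: "real \<Rightarrow> real ^ 'n"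
  proof -
    \<comment> \<open>Chosen so that the final bound
      \<open>\<eta> * (b - a) + \<eta> ^ p / \<eta> ^ (p - 1)\<close> equals \<epsilon>.\<close>
    define \<eta> where "\<eta> = \<epsilon> / (b - a + 1)"
    have "\<eta> * (b - a + 1) = \<epsilon>"
      using ab by (simp add: \<eta>_def)
    then have \<eta>2: "\<eta> * (b - a) + \<eta> = \<epsilon>"
      by (simp add: distrib_left)
    have \<eta>1: "0 < \<eta>"
      using \<open>0 < \<epsilon>\<close> ab by (simp add: \<eta>_def)
    note \<eta> = \<eta>1 \<eta>2
    have "\<forall>\<^sub>F n in sequentially. seminorm_ThetaB p (m_bounds_moduli E) a b J (fs n - f) < \<eta>"
      by (rule limitin_seminorm_topology(2)[where s = "seminorm_ThetaB p (m_bounds_moduli E) a b J",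
            OF lim[unfolded T_ThetaB_def] _ seminorm_ThetaB_zero[OF p] \<eta>1])
        (use ab in blast)
    then show ?thesis
    proof eventually_elim
      case (elim n)
      show ?case
      proof (intro allI impI, elim conjE)
        fix \<tau> y
        assume \<tau>: "a \<le> \<tau>" "\<tau> \<le> b" and y: "solves_on (fs n) a \<tau> y"
          and yb: "\<forall>s \<in> {a-1..\<tau>}. norm (y s) \<le> real j + 1"
        define F where "F = fs n - f"
        \<comment> \<open>\<open>X\<close> and \<open>U\<close> extend the current and the delayed
          argument to all of \<open>{a..b}\<close> and agree with them up to \<tau>.
          \<open>X\<close> must keep its modulus; \<open>U\<close> only has to be continuous and
          bounded by \<open>J\<close>.\<close>
        define X where "X t = y (min t \<tau>)" for t
        define U where "U t = y (min t (\<tau> - 1))" for t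
        define v where "v t = norm (F t (X t, U (t - 1)))" for t
        have yc: "continuous_on {a-1..\<tau>} y"
          by (rule solves_on_continuous[OF y])
        have F: "F \<in> LC p" "F \<in> LC 1"
          using LC_diff[OF _ f, of "fs n"] E fs LC_subset_LC1[OF p] by (auto simp: F_def)
        have X: "X \<in> K_set (m_bounds_moduli E) a b J"
          unfolding X_def by (rule \<rho>(2)[OF fs]) (use ab \<tau> y yb in auto)
        have Uc: "continuous_on {a-1..b-1} U"
          unfolding U_def using \<tau> by (intro continuous_on_compose2[OF yc] continuous_intros) auto
        have "norm (U t) \<le> real J" if "t \<in> {a-1..b-1}" for t
        proof -
          have "norm (U t) \<le> real j + 1"
            using yb \<tau> that by (auto simp: U_def)
          then show ?thesis by (simp add: J_def)
        qed
        then have U: "U \<in> C_ball (a - 1) (b - 1) J"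
          using Uc by (auto simp: C_ball_def)
        have vp: "set_integrable lebesgue {a..b} (\<lambda>t. v t ^ p)"
          unfolding v_def by (rule seminorm_ThetaB_upper(1)[OF F(1) p X U])
        have "root p (LINT t:{a..b}|lebesgue. v t ^ p) \<le> \<eta>"
          using seminorm_ThetaB_upper(2)[OF F(1) p X U] elim by (simp add: v_def F_def)
        then have "root p (LINT t:{a..b}|lebesgue. v t ^ p) ^ p \<le> \<eta> ^ p"
          using p by (intro power_mono real_root_ge_zero)
            (auto simp: v_def set_lebesgue_integral_def intro!: integral_nonneg)
        moreover have nn: "0 \<le> (LINT t:{a..b}|lebesgue. v t ^ p)"
          by (auto simp: v_def set_lebesgue_integral_def intro!: integral_nonneg)
        ultimately have small: "(LINT t:{a..b}|lebesgue. v t ^ p) \<le> \<eta> ^ p"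
          using p by simp
        have c: "set_integrable lebesgue {a..b} (\<lambda>t. \<eta>)"
          by (rule absolutely_integrable_on_const) simp
        have w: "set_integrable lebesgue {a..b} (\<lambda>t. \<eta> + v t ^ p / \<eta> ^ (p - 1))"
          using vp c by simp
        have "(LINT s:{a..\<tau>}|lebesgue. F s (y s, y (s - 1))) = (LINT s:{a..\<tau>}|lebesgue. F s (X s, U (s - 1)))"
          by (intro set_lebesgue_integral_cong) (auto simp: X_def U_def)
        also have "norm \<dots> \<le> (LINT s:{a..\<tau>}|lebesgue. \<eta> + v s ^ p / \<eta> ^ (p - 1))"
        proof (rule norm_set_integral_le)
          have "continuous_on {a..b} X"
            using X by (auto simp: K_set_def C_ball_def)
          then show "set_integrable lebesgue {a..\<tau>} (\<lambda>s. F s (X s, U (s - 1)))"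
            using \<tau> Uc by (intro set_integrable_delay F(2)) (auto intro: continuous_on_subset)
          show "set_integrable lebesgue {a..\<tau>} (\<lambda>s. \<eta> + v s ^ p / \<eta> ^ (p - 1))"
            using set_integrable_subset[OF w] \<tau> by auto
          show "AE s in lebesgue. s \<in> {a..\<tau>} \<longrightarrow> norm (F s (X s, U (s - 1))) \<le> \<eta> + v s ^ p / \<eta> ^ (p - 1)"
            using le_add_power_quotient[OF _ \<eta>(1) p] by (auto simp: v_def)
        qed
        also have "\<dots> \<le> (LINT s:{a..b}|lebesgue. \<eta> + v s ^ p / \<eta> ^ (p - 1))"
        proof -
          have "0 \<le> (LINT s:{\<tau>..b}|lebesgue. \<eta> + v s ^ p / \<eta> ^ (p - 1))"
            using \<eta>(1) by (auto simp: v_def set_lebesgue_integral_def intro!: integral_nonneg add_nonneg_nonneg)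
          then show ?thesis
            using set_integral_combine[OF w \<tau>] by simp
        qed
        also have "\<dots> = (LINT s:{a..b}|lebesgue. \<eta>) + (LINT s:{a..b}|lebesgue. v s ^ p) / \<eta> ^ (p - 1)"
          using vp c by simp
        also have "\<dots> \<le> \<eta> * (b - a) + \<eta> ^ p / \<eta> ^ (p - 1)"
          using small \<eta>(1) ab set_lebesgue_integral_eq_integral(2)[OF c]
          by (intro add_mono divide_right_mono) auto
        also have "\<eta> ^ p / \<eta> ^ (p - 1) = \<eta>"
          using p \<eta>(1) by (cases p) auto
        finally show "norm (LINT s:{a..\<tau>}|lebesgue. (fs n - f) s (y s, y (s - 1))) \<le> \<epsilon>"
          unfolding F_def using \<eta>(2) by simp
      qed
    qed
  qed
  \<comment> \<open>The estimate covers every past bounded by \<open>real j + 1\<close>, so any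
    positive \<delta> is a witness; \<open>1\<close> is taken.\<close>
  then show "\<exists>\<rho>>0. \<forall>a b x \<epsilon>. a \<in> \<rat> \<and> b \<in> \<rat> \<and> 0 \<le> a \<and> a \<le> b \<and> b \<le> r \<and>
     b - a < \<rho> \<and> 0 < \<epsilon> \<and> continuous_on {a-1..a} x \<and> (\<forall>s \<in> {a-1..a}. norm (x s) \<le> real j) \<longrightarrow>
     (\<exists>\<delta>>0. \<forall>\<^sub>F n in sequentially. \<forall>\<tau> y. a \<le> \<tau> \<and> \<tau> \<le> b \<and> solves_on (fs n) a \<tau> y \<and>
        (\<forall>s \<in> {a-1..\<tau>}. norm (y s) \<le> real j + 1) \<and> (\<forall>s \<in> {a-1..a}. norm (y s - x s) \<le> \<delta>) \<longrightarrow>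
        norm (LINT s:{a..\<tau>}|lebesgue. (fs n - f) s (y s, y (s - 1))) \<le> \<epsilon>)"
    using \<rho>(1) by (intro exI[of _ \<rho>] conjI allI impI exI[of _ 1]) auto
qed

section \<open>Convergence with frozen delayed argument: step functions on a grid\<close>

text \<open>The weight \<open>l2_bound g J\<close> is not known to be measurable, so \<eta> is not
  pulled out of its integral. It is moved to the integrand instead: the difference divided by \<eta>
  is dominated pointwise by the weight.\<close>

lemma l2_bound_integral:
  fixes g :: "('n::finite) delay_rhs"
  assumes int: "set_integrable lebesgue S (\<lambda>s. g s (y s, w s) - g s (y s, v s))"
    and ball: "\<And>s. s \<in> S \<Longrightarrow> norm (y s, w s) \<le> real J \<and> norm (y s, v s) \<le> real J"
    and close: "\<And>s. s \<in> S \<Longrightarrow> norm (w s - v s) \<le> \<eta>" and "0 < \<eta>"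
    and l2: "(\<integral>\<^sup>+s\<in>S. l2_bound g J s \<partial>lebesgue) \<le> ennreal C" and "0 \<le> C"
  shows "norm (LINT s:S|lebesgue. g s (y s, w s) - g s (y s, v s)) \<le> \<eta> * C"
proof -
  define H where "H s = g s (y s, w s) - g s (y s, v s)" for s
  have "ennreal (norm (LINT s:S|lebesgue. (1 / \<eta>) *\<^sub>R H s)) \<le> (\<integral>\<^sup>+s\<in>S. l2_bound g J s \<partial>lebesgue)"
  proof (rule norm_set_integral_le_nn_integral)
    show "set_integrable lebesgue S (\<lambda>s. (1 / \<eta>) *\<^sub>R H s)"
      using int unfolding H_def by (intro set_integrable_scaleR_right)
    fix s assume s: "s \<in> S"
    show "ennreal (norm ((1 / \<eta>) *\<^sub>R H s)) \<le> l2_bound g J s"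
    proof (cases "w s = v s")
      case True
      then show ?thesis by (simp add: H_def)
    next
      case False
      have "norm ((1 / \<eta>) *\<^sub>R H s) = norm (H s) / \<eta>"
        using \<open>0 < \<eta>\<close> by simp
      also have "\<dots> \<le> norm (H s) / norm (w s - v s)"
        using False close[OF s] by (intro divide_left_mono mult_pos_pos \<open>0 < \<eta>\<close>) auto
      finally have "ennreal (norm ((1 / \<eta>) *\<^sub>R H s)) \<le> ennreal (norm (H s) / norm (w s - v s))"
        by (rule ennreal_leI)
      also have "\<dots> \<le> l2_bound g J s"
        unfolding l2_bound_def H_def
        by (rule SUP_upper2[of "(y s, w s, v s)"]) (use False ball[OF s] in auto)
      finally show ?thesis .
    qed
  qed
  also note l2
  finally have "norm (LINT s:S|lebesgue. (1 / \<eta>) *\<^sub>R H s) \<le> C"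
    using \<open>0 \<le> C\<close> by simp
  then have "norm ((1 / \<eta>) *\<^sub>R (LINT s:S|lebesgue. H s)) \<le> C"
    by simp
  then show ?thesis
    using \<open>0 < \<eta>\<close> by (simp add: H_def pos_divide_le_eq mult.commute)
qed

text \<open>Counterpart of \<open>l2_bound_integral\<close> for the limit \<open>f\<close>, whose
  bound comes from \<open>LC 1\<close> because \<open>f\<close> may lie outside \<open>E\<close>.
  The first components coincide, so only the delayed difference counts.\<close>

lemma rhs_integral_lipschitz:
  fixes f :: "('n::finite) delay_rhs"
  assumes int: "set_integrable lebesgue S (\<lambda>s. f s (y s, w s) - f s (y s, v s))"
    and l: "set_integrable lebesgue S l" "\<And>s. 0 \<le> l s"
    and lip: "AE s in lebesgue. \<forall>z1 \<in> cball 0 R. \<forall>z2 \<in> cball 0 R. norm (f s z1 - f s z2) \<le> l s * norm (z1 - z2)"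
    and ball: "\<And>s. s \<in> S \<Longrightarrow> norm (y s, w s) \<le> R \<and> norm (y s, v s) \<le> R"
    and close: "\<And>s. s \<in> S \<Longrightarrow> norm (w s - v s) \<le> \<eta>"
  shows "norm (LINT s:S|lebesgue. f s (y s, w s) - f s (y s, v s)) \<le> \<eta> * (LINT s:S|lebesgue. l s)"
proof -
  have "norm (LINT s:S|lebesgue. f s (y s, w s) - f s (y s, v s)) \<le> (LINT s:S|lebesgue. \<eta> * l s)"
  proof (rule norm_set_integral_le[OF int])
    show "set_integrable lebesgue S (\<lambda>s. \<eta> * l s)"
      using l by simp
    show "AE s in lebesgue. s \<in> S \<longrightarrow> norm (f s (y s, w s) - f s (y s, v s)) \<le> \<eta> * l s"
      using lip
    proof eventually_elim
      case (elim s)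
      show ?case
      proof
        assume s: "s \<in> S"
        have "norm (f s (y s, w s) - f s (y s, v s)) \<le> l s * norm ((y s, w s) - (y s, v s))"
          by (intro elim[rule_format]) (use ball[OF s] in auto)
        also have "\<dots> \<le> l s * \<eta>"
          using close[OF s] l(2)[of s] by (intro mult_left_mono) (simp_all add: norm_Pair)
        finally show "norm (f s (y s, w s) - f s (y s, v s)) \<le> \<eta> * l s"
          by (simp add: mult.commute)
      qed
    qed
  qed
  then show ?thesis by simp
qed

lemma grid_floor:
  fixes a h \<tau> :: real
  assumes "0 < h" "a \<le> \<tau>" "\<tau> \<le> a + real N * h"
  obtains k where "k \<le> N" "a + real k * h \<le> \<tau>" "\<tau> - (a + real k * h) < h"
proof
  define k where "k = nat \<lfloor>(\<tau> - a) / h\<rfloor>"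
  have nn: "0 \<le> (\<tau> - a) / h"
    using assms by simp
  then have k: "real k \<le> (\<tau> - a) / h" "(\<tau> - a) / h < real k + 1"
    unfolding k_def by linarith+
  show "a + real k * h \<le> \<tau>" "\<tau> - (a + real k * h) < h"
    using k assms(1) by (auto simp: field_simps)
  have "(\<tau> - a) / h \<le> real N"
    using assms by (simp add: field_simps)
  then show "k \<le> N"
    using k(1) by linarith
qed

text \<open>Rounding up makes the cells open on the left and closed on the right.\<close>

lemma grid_cell:
  fixes a h s :: real
  assumes "0 < h" "a + real i * h < s" "s \<le> a + real (Suc i) * h"
  shows "nat \<lceil>(s - a) / h\<rceil> - 1 = i"
proof -
  have "real i < (s - a) / h" "(s - a) / h \<le> real (Suc i)"
    using assms by (auto simp: field_simps)
  then have "\<lceil>(s - a) / h\<rceil> = int (Suc i)"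
    by (intro ceiling_unique) auto
  then show ?thesis
    by simp
qed

text \<open>With right-closed cells the endpoint \<open>a + real N * h\<close> has index
  \<open>N - 1\<close>. At \<open>s = a\<close> the ceiling is \<open>0\<close>, and truncated
  subtraction assigns the first cell.\<close>

lemma grid_index:
  fixes a h s :: real
  assumes "0 < h" "a \<le> s" "s \<le> a + real N * h" "0 < N"
  shows "nat \<lceil>(s - a) / h\<rceil> - 1 < N"
    and "\<bar>s - (a + real (nat \<lceil>(s - a) / h\<rceil> - 1) * h)\<bar> \<le> h"
proof -
  define c where "c = \<lceil>(s - a) / h\<rceil>"
  have q: "0 \<le> (s - a) / h" "(s - a) / h \<le> real N"
    using assms by (auto simp: field_simps)
  have c: "0 \<le> c" "c \<le> int N" "(s - a) / h \<le> real_of_int c" "real_of_int c < (s - a) / h + 1"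
    using q unfolding c_def by linarith+
  show "nat \<lceil>(s - a) / h\<rceil> - 1 < N"
    using c(1,2) assms(4) unfolding c_def[symmetric] by linarith
  have "\<bar>(s - a) / h - real (nat c - 1)\<bar> \<le> 1"
    using c q by (cases "c = 0") (auto simp: of_nat_diff nat_le_iff abs_le_iff)
  then have "\<bar>(s - a) / h - real (nat c - 1)\<bar> * h \<le> 1 * h"
    using assms(1) by (intro mult_right_mono) auto
  also have "\<bar>(s - a) / h - real (nat c - 1)\<bar> * h = \<bar>s - (a + real (nat c - 1) * h)\<bar>"
  proof -
    have "\<bar>(s - a) / h - real (nat c - 1)\<bar> * h = \<bar>((s - a) / h - real (nat c - 1)) * h\<bar>"
      using assms(1) by (simp add: abs_mult)
    also have "((s - a) / h - real (nat c - 1)) * h = s - (a + real (nat c - 1) * h)"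
      using assms(1) by (simp add: field_simps)
    finally show ?thesis .
  qed
  finally show "\<bar>s - (a + real (nat \<lceil>(s - a) / h\<rceil> - 1) * h)\<bar> \<le> h"
    by (simp add: c_def)
qed

lemma set_integral_singleton:
  fixes g :: "real \<Rightarrow> 'a::euclidean_space"
  shows "(LINT s:{a}|lebesgue. g s) = 0"
proof -
  have "(LINT s:{a}|lebesgue. g s) = (LINT s|lebesgue. indicator {a} s *\<^sub>R g a)"
    unfolding set_lebesgue_integral_def by (intro Bochner_Integration.integral_cong) (auto split: split_indicator)
  then show ?thesis
    by simp
qed

text \<open>Each of the \<open>k\<close> cells contributes at most \<kappa>. At the left endpoint of
  a cell \<open>v\<close> may differ from \<open>u i\<close>; that single point is negligible and is
  removed by \<open>integral_spike\<close>.\<close>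

lemma solution_grid_estimate:
  fixes F :: "('n::finite) delay_rhs"
  assumes W: "set_integrable lebesgue {a..a + real k * h} (\<lambda>s. F s (y s, v s))" and "0 < h"
    and F: "F \<in> LC 1"
    and v: "\<And>i s. i < k \<Longrightarrow> a + real i * h < s \<Longrightarrow> s \<le> a + real (Suc i) * h \<Longrightarrow> v s = u i"
    and y: "continuous_on {a..a + real k * h} y"
    and cell: "\<And>i. i < k \<Longrightarrow> norm (LINT s:{a + real i * h..a + real (Suc i) * h}|lebesgue. F s (y s, u i)) \<le> \<kappa>"
  shows "norm (LINT s:{a..a + real k * h}|lebesgue. F s (y s, v s)) \<le> real k * \<kappa>"
proof -
  have "norm (LINT s:{a..a + real k' * h}|lebesgue. F s (y s, v s)) \<le> real k' * \<kappa>" if "k' \<le> k" for k'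
    using that
  proof (induction k')
    case 0
    then show ?case by (simp add: set_integral_singleton)
  next
    case (Suc i)
    define p q where "p = a + real i * h" and "q = a + real (Suc i) * h"
    have "real (Suc i) * h \<le> real k * h"
      using Suc \<open>0 < h\<close> by (intro mult_right_mono) auto
    then have pq: "a \<le> p" "p \<le> q" "q \<le> a + real k * h"
      using \<open>0 < h\<close> by (auto simp: p_def q_def algebra_simps)
    have W1: "set_integrable lebesgue {a..q} (\<lambda>s. F s (y s, v s))"
      using set_integrable_subset[OF W] pq by auto
    have W2: "set_integrable lebesgue {p..q} (\<lambda>s. F s (y s, v s))"
      using set_integrable_subset[OF W] pq by auto
    have "continuous_on {p..q} y"
      using pq by (intro continuous_on_subset[OF y]) auto
    then have U: "set_integrable lebesgue {p..q} (\<lambda>s. F s (y s, u i))"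
      using set_integrable_delay[OF F, of p q y "\<lambda>_. u i"] by simp
    have "(LINT s:{p..q}|lebesgue. F s (y s, v s)) = integral {p..q} (\<lambda>s. F s (y s, v s))"
      by (rule set_lebesgue_integral_eq_integral(2)[OF W2])
    also have "\<dots> = integral {p..q} (\<lambda>s. F s (y s, u i))"
      by (rule integral_spike[OF negligible_sing[of p]]) (use v[of i] Suc in \<open>auto simp: p_def q_def\<close>)
    also have "\<dots> = (LINT s:{p..q}|lebesgue. F s (y s, u i))"
      by (rule set_lebesgue_integral_eq_integral(2)[OF U, symmetric])
    finally have "norm (LINT s:{p..q}|lebesgue. F s (y s, v s)) \<le> \<kappa>"
      using cell[of i] Suc by (simp add: p_def q_def)
    moreover have "norm (LINT s:{a..p}|lebesgue. F s (y s, v s)) \<le> real i * \<kappa>"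
      using Suc by (simp add: p_def)
    moreover have "(LINT s:{a..q}|lebesgue. F s (y s, v s)) =
        (LINT s:{a..p}|lebesgue. F s (y s, v s)) + (LINT s:{p..q}|lebesgue. F s (y s, v s))"
      by (rule set_integral_combine[OF W1 pq(1,2)])
    ultimately have "norm (LINT s:{a..q}|lebesgue. F s (y s, v s)) \<le> real i * \<kappa> + \<kappa>"
      using norm_triangle_ineq[of "LINT s:{a..p}|lebesgue. F s (y s, v s)" "LINT s:{p..q}|lebesgue. F s (y s, v s)"]
      by simp
    then show ?case
      by (simp add: q_def algebra_simps)
  qed
  then show ?thesis by blast
qed

text \<open>The index is integer valued, so measurability factors through a discrete space and
  \<open>u\<close> may be any sequence.\<close>

lemma borel_measurable_ceiling_step:
  fixes u :: "nat \<Rightarrow> 'a::euclidean_space"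
  shows "(\<lambda>s::real. u (nat \<lceil>(s - a) / h\<rceil> - 1)) \<in> borel_measurable borel"
proof -
  have "(\<lambda>s::real. \<lceil>(s - a) / h\<rceil>) \<in> borel \<rightarrow>\<^sub>M count_space UNIV"
    by measurable
  moreover have "(\<lambda>c. u (nat c - 1)) \<in> borel_measurable (count_space UNIV)"
    by simp
  ultimately show ?thesis
    by (rule measurable_compose)
qed

text \<open>The seminorms see the delayed argument only as a constant in \<open>D\<close>, so the
  delayed solution is traded for a function constant on each cell. The price is the distance times a
  Lipschitz bound in the second variable, uniform in \<open>n\<close> by the
  \<open>l2\<close>-bounds of \<open>E\<close>.\<close>

lemma sigma_ThetaD_converges_along_solutions:
  fixes E :: "('n::finite) delay_rhs set"
  assumes E: "E \<subseteq> LC 1" and equi: "L1loc_equicontinuous_m_bounds E"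
    and l2: "L1loc_bounded_l2_bounds E" and D: "closure D = UNIV"
    and fs: "\<And>n. fs n \<in> E"
    and lim: "limitin (sigma_ThetaD (m_bounds_moduli E) D) fs f sequentially"
  shows "converges_along_solutions fs f"
  unfolding converges_along_solutions_def
proof (intro allI)
  fix j :: nat and r :: real
  define J where "J = 2 * j + 2"
  \<comment> \<open>Positive for every \<open>r\<close>, as both hypotheses on \<open>E\<close>
    require of a radius; \<open>{-R..R}\<close> contains every interval with
    \<open>0 \<le> a \<le> b \<le> r\<close>.\<close>
  define R where "R = \<bar>r\<bar> + 1"
  have f: "f \<in> LC 1"
    using limitin_seminorm_topology(1)[OF lim[unfolded sigma_ThetaD_def]] .
  have fs1: "fs n \<in> LC 1" for n
    using fs E by blast
  obtain \<rho> where \<rho>: "\<rho> > 0" "\<And>g a b \<tau> y. g \<in> E \<Longrightarrow> 0 \<le> a \<Longrightarrow> a \<le> \<tau> \<Longrightarrow> \<tau> \<le> b \<Longrightarrow> b \<le> r \<Longrightarrow> b - a < \<rho> \<Longrightarrow>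
      solves_on g a \<tau> y \<Longrightarrow> (\<forall>s \<in> {a-1..\<tau>}. norm (y s) \<le> real j + 1) \<Longrightarrow>
      (\<lambda>t. y (min t \<tau>)) \<in> K_set (m_bounds_moduli E) a b J"
    using solution_in_K_set[OF equi E, of r j] unfolding J_def by blast
  obtain C where C: "0 \<le> C" "\<And>g. g \<in> E \<Longrightarrow> (\<integral>\<^sup>+t\<in>{-R..R}. l2_bound g J t \<partial>lebesgue) \<le> ennreal C"
  proof -
    define S where "S = (SUP g \<in> E. \<integral>\<^sup>+t\<in>{-R..R}. l2_bound g J t \<partial>lebesgue)"
    have "0 < R"
      by (simp add: R_def)
    then have "S < \<infinity>"
      using l2 unfolding L1loc_bounded_l2_bounds_def S_def by blast
    then have S: "S = ennreal (enn2real S)"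
      by simp
    have "(\<integral>\<^sup>+t\<in>{-R..R}. l2_bound g J t \<partial>lebesgue) \<le> ennreal (enn2real S)" if "g \<in> E" for g
      unfolding S[symmetric] unfolding S_def using that by (rule SUP_upper)
    then show thesis
      by (intro that[of "enn2real S"]) auto
  qed
  obtain m l where ml: "\<And>a b. set_integrable lebesgue {a..b} m" "\<And>a b. set_integrable lebesgue {a..b} l"
    "\<And>t. 0 \<le> m t" "\<And>t. 0 \<le> l t"
    "AE t in lebesgue. (\<forall>z \<in> cball 0 (real J). norm (f t z) \<le> m t) \<and>
      (\<forall>z1 \<in> cball 0 (real J). \<forall>z2 \<in> cball 0 (real J). norm (f t z1 - f t z2) \<le> l t * norm (z1 - z2))"
    by (rule LC1_bounds[OF f that])
  have ae_m: "AE t in lebesgue. \<forall>z \<in> cball 0 (real J). norm (f t z) \<le> m t"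
    using ml(5) by eventually_elim blast
  have ae_l: "AE t in lebesgue. \<forall>z1 \<in> cball 0 (real J). \<forall>z2 \<in> cball 0 (real J). norm (f t z1 - f t z2) \<le> l t * norm (z1 - z2)"
    using ml(5) by eventually_elim blast
  have main: "\<exists>\<delta>>0. \<forall>\<^sub>F n in sequentially. \<forall>\<tau> y. a \<le> \<tau> \<and> \<tau> \<le> b \<and> solves_on (fs n) a \<tau> y \<and>
        (\<forall>s \<in> {a-1..\<tau>}. norm (y s) \<le> real j + 1) \<and> (\<forall>s \<in> {a-1..a}. norm (y s - x s) \<le> \<delta>) \<longrightarrow>
        norm (LINT s:{a..\<tau>}|lebesgue. (fs n - f) s (y s, y (s - 1))) \<le> \<epsilon>"
    if ab: "a \<in> \<rat>" "b \<in> \<rat>" "0 \<le> a" "a \<le> b" "b \<le> r" "b - a < min \<rho> 1" and "0 < \<epsilon>"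
      and xc: "continuous_on {a-1..a} x" and xb: "\<forall>s \<in> {a-1..a}. norm (x s) \<le> real j"
    for a b \<epsilon> and x :: "real \<Rightarrow> real ^ 'n"
  proof (cases "a = b")
    \<comment> \<open>Treated apart because the mesh in the other case has to be positive.\<close>
    case True
    have "norm (LINT s:{a..\<tau>}|lebesgue. (fs n - f) s (y s, y (s - 1))) \<le> \<epsilon>"
      if "a \<le> \<tau>" "\<tau> \<le> b" for \<tau> n and y :: "real \<Rightarrow> real ^ 'n"
    proof -
      have "\<tau> = a" using that True by simp
      then show ?thesis
        using \<open>0 < \<epsilon>\<close> by (simp add: set_integral_singleton)
    qed
    then show ?thesis
      by (intro exI[of _ 1]) auto
  next
    case False
    define L where "L = (LINT s:{a..b}|lebesgue. l s)"
    have "0 \<le> L"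
      using ml(4) by (auto simp: L_def set_lebesgue_integral_def intro!: integral_nonneg)
    \<comment> \<open>\<open>C\<close> bounds the \<open>l2\<close>-integrals of all
      \<open>fs n\<close> and \<open>L\<close> is the Lipschitz integral of \<open>f\<close>, so
      freezing at accuracy \<eta> costs at most \<open>\<epsilon> / 4\<close>. The summand
      \<open>1\<close> keeps the divisor positive; the cap \<open>\<eta> \<le> 1\<close> keeps the
      step function within radius \<open>real j + 1\<close>.\<close>
    define K where "K = C + L + 1"
    have "0 < K"
      using \<open>0 \<le> L\<close> \<open>0 \<le> C\<close> by (simp add: K_def)
    define \<eta> where "\<eta> = min 1 (\<epsilon> / (4 * K))"
    have \<eta>: "0 < \<eta>" "\<eta> \<le> 1"
      using \<open>0 < K\<close> \<open>0 < \<epsilon>\<close> by (auto simp: \<eta>_def)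
    have \<eta>CL: "\<eta> * C + \<eta> * L \<le> \<epsilon> / 4"
    proof -
      have "\<eta> * (C + L) \<le> \<eta> * K"
        using \<eta>(1) by (intro mult_left_mono) (auto simp: K_def)
      also have "\<dots> \<le> \<epsilon> / (4 * K) * K"
        using \<open>0 < K\<close> by (intro mult_right_mono) (auto simp: \<eta>_def)
      also have "\<dots> = \<epsilon> / 4"
        using \<open>0 < K\<close> by simp
      finally show ?thesis
        by (simp add: distrib_left)
    qed
    have "uniformly_continuous_on {a-1..a} x"
      by (intro compact_uniformly_continuous xc) auto
    \<comment> \<open>Three thirds of \<eta>: from \<open>y (s - 1)\<close> to
      \<open>x (s - 1)\<close>, from there to \<open>x\<close> at the shifted grid point, and from
      there to a value in \<open>D\<close>.\<close>
    then obtain d where d: "d > 0" "\<And>s s'. s \<in> {a-1..a} \<Longrightarrow> s' \<in> {a-1..a} \<Longrightarrow> \<bar>s' - s\<bar> < d \<Longrightarrow> norm (x s' - x s) < \<eta> / 3"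
      using \<eta>(1) unfolding uniformly_continuous_on_def dist_norm real_norm_def
      by (metis zero_less_divide_iff zero_less_numeral)
    obtain \<delta>2 where \<delta>2: "\<delta>2 > 0" "\<And>s t. - R \<le> s \<Longrightarrow> s \<le> t \<Longrightarrow> t \<le> R \<Longrightarrow> t - s < \<delta>2 \<Longrightarrow>
        (SUP f \<in> E. \<integral>\<^sup>+\<tau>\<in>{s..t}. m_bound f J \<tau> \<partial>lebesgue) < ennreal (\<epsilon> / 4)"
    proof -
      have "0 < R" "0 < \<epsilon> / 4" using \<open>0 < \<epsilon>\<close> by (auto simp: R_def)
      then have "\<exists>\<delta>>0. \<forall>s t. - R \<le> s \<and> s \<le> t \<and> t \<le> R \<and> t - s < \<delta> \<longrightarrow>
          (SUP f \<in> E. \<integral>\<^sup>+\<tau>\<in>{s..t}. m_bound f J \<tau> \<partial>lebesgue) < ennreal (\<epsilon> / 4)"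
        using equi unfolding L1loc_equicontinuous_m_bounds_def by blast
      then show thesis using that by blast
    qed
    obtain \<rho>m where \<rho>m: "\<rho>m > 0" "\<And>a b. 0 \<le> a \<Longrightarrow> a \<le> b \<Longrightarrow> b \<le> r \<Longrightarrow> b - a < \<rho>m \<Longrightarrow>
        (LINT s:{a..b}|lebesgue. m s) < \<epsilon> / 4"
      using small_set_integrals[OF ml(1), of "\<epsilon> / 4" r] \<open>0 < \<epsilon>\<close> by auto
    \<comment> \<open>Below \<open>d\<close> the function \<open>x\<close> varies by less than
      \<open>\<eta> / 3\<close> across a cell; below \<delta>2 and \<rho>m the piece after the last
      grid point costs less than \<open>\<epsilon> / 4\<close> for \<open>fs n\<close> and for
      \<open>f\<close>.\<close>
    define h0 where "h0 = min d (min \<delta>2 \<rho>m)"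
    have h0: "0 < h0" using d \<delta>2 \<rho>m by (simp add: h0_def)
    obtain N :: nat where N: "b - a < real N * h0"
      using ex_less_of_nat_mult[OF h0] by blast
    have "0 < N"
      using N False ab by (cases N) auto
    \<comment> \<open>Equal division of a rational length keeps all grid points rational, so every
      cell has a seminorm.\<close>
    define h where "h = (b - a) / real N"
    have h: "0 < h" "h < h0" and b_eq: "a + real N * h = b" and "h \<in> \<rat>"
      using N \<open>0 < N\<close> False ab by (auto simp: h_def divide_less_eq mult.commute)
    define q where "q i = a + real i * h" for i
    have q_rat: "q i \<in> \<rat>" for i
      using ab \<open>h \<in> \<rat>\<close> by (simp add: q_def)
    have q_mono: "q i \<le> q k" if "i \<le> k" for i k
      using that h(1) by (auto simp: q_def intro!: mult_right_mono)
    have q_ab: "a \<le> q i" "i \<le> N \<Longrightarrow> q i \<le> b" for i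
      using q_mono[of 0 i] q_mono[of i N] b_eq by (auto simp: q_def)
    have "\<exists>u \<in> D. norm (u - x (q i - 1)) < \<eta> / 3" for i
    proof -
      have "x (q i - 1) \<in> closure D" "0 < \<eta> / 3"
        using D \<eta>(1) by auto
      then show ?thesis
        unfolding closure_approachable dist_norm by blast
    qed
    \<comment> \<open>Grid and values depend on \<open>x\<close>, not on \<open>n\<close> or
      \<open>y\<close>; finitely many seminorms, one per cell, therefore decide from which
      \<open>n\<close> on the estimate holds.\<close>
    then obtain u where u: "\<And>i. u i \<in> D" "\<And>i. norm (u i - x (q i - 1)) < \<eta> / 3"
      by metis
    have small: "\<forall>\<^sub>F n in sequentially. seminorm_ThetaD (m_bounds_moduli E) (q i) (q (Suc i)) J (u i) (fs n - f) < \<epsilon> / (4 * real N)" for i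
    proof (rule limitin_seminorm_topology(2)[where s = "seminorm_ThetaD (m_bounds_moduli E) (q i) (q (Suc i)) J (u i)",
          OF lim[unfolded sigma_ThetaD_def] _ seminorm_ThetaD_zero])
      have "q i \<le> q (Suc i)"
        by (rule q_mono) simp
      then show "seminorm_ThetaD (m_bounds_moduli E) (q i) (q (Suc i)) J (u i) \<in>
          {seminorm_ThetaD (m_bounds_moduli E) q1 q2 j u | q1 q2 j u. q1 \<in> \<rat> \<and> q2 \<in> \<rat> \<and> q1 \<le> q2 \<and> u \<in> D}"
        using q_rat u(1) by blast
      show "0 < \<epsilon> / (4 * real N)"
        using \<open>0 < \<epsilon>\<close> \<open>0 < N\<close> by simp
    qed
    have "\<forall>\<^sub>F n in sequentially. \<forall>i \<in> {..<N}. seminorm_ThetaD (m_bounds_moduli E) (q i) (q (Suc i)) J (u i) (fs n - f) < \<epsilon> / (4 * real N)"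
      by (intro eventually_ball_finite ballI small) simp
    then have "\<forall>\<^sub>F n in sequentially. \<forall>\<tau> y. a \<le> \<tau> \<and> \<tau> \<le> b \<and> solves_on (fs n) a \<tau> y \<and>
        (\<forall>s \<in> {a-1..\<tau>}. norm (y s) \<le> real j + 1) \<and> (\<forall>s \<in> {a-1..a}. norm (y s - x s) \<le> \<eta> / 3) \<longrightarrow>
        norm (LINT s:{a..\<tau>}|lebesgue. (fs n - f) s (y s, y (s - 1))) \<le> \<epsilon>"
    proof eventually_elim
      case (elim n)
      show ?case
      proof (intro allI impI, elim conjE)
        fix \<tau> y
        assume \<tau>: "a \<le> \<tau>" "\<tau> \<le> b" and y: "solves_on (fs n) a \<tau> y"
          and yb': "\<forall>s \<in> {a-1..\<tau>}. norm (y s) \<le> real j + 1"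
          and near': "\<forall>s \<in> {a-1..a}. norm (y s - x s) \<le> \<eta> / 3"
        note yb = bspec[OF yb'] and near = bspec[OF near']
        define F where "F = fs n - f"
        have F: "F \<in> LC 1"
          unfolding F_def by (rule LC_diff[OF fs1 f])
        have yc: "continuous_on {a-1..\<tau>} y"
          by (rule solves_on_continuous[OF y])
        obtain k where k: "k \<le> N" "q k \<le> \<tau>" "\<tau> - q k < h"
          using grid_floor[of h a \<tau> N] h(1) \<tau> b_eq unfolding q_def by auto
        \<comment> \<open>Budget: on \<open>{a..c}\<close>, \<open>\<epsilon> / 4\<close> for the
          step function and \<open>\<epsilon> / 4\<close> for replacing the delayed solution by it;
          on \<open>{c..\<tau>}\<close>, \<open>\<epsilon> / 2\<close>.\<close>
        define c where "c = q k"
        have c: "a \<le> c" "c \<le> \<tau>" "\<tau> - c < h"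
          using q_ab k by (auto simp: c_def)
        define v where "v s = u (nat \<lceil>(s - a) / h\<rceil> - 1)" for s
        have v: "norm (v s - x (s - 1)) \<le> 2 * \<eta> / 3" if s: "s \<in> {a..c}" for s
        proof -
          define i where "i = nat \<lceil>(s - a) / h\<rceil> - 1"
          have "s \<le> a + real N * h"
            using s c \<tau> b_eq by simp
          then have i: "i < N" "\<bar>s - q i\<bar> \<le> h"
            using grid_index[of h a s N] h(1) s \<open>0 < N\<close> by (auto simp: i_def q_def)
          have "norm (x (q i - 1) - x (s - 1)) < \<eta> / 3"
            using i s c \<tau> ab q_ab[of i] h h0_def by (intro d(2)) auto
          then have "norm ((u i - x (q i - 1)) + (x (q i - 1) - x (s - 1))) \<le> \<eta> / 3 + \<eta> / 3"
            using u(2)[of i] by (intro norm_triangle_le) linarith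
          then show ?thesis by (simp add: v_def i_def)
        qed
        have past: "s - 1 \<in> {a-1..a}" if "s \<in> {a..c}" for s
          using that c \<tau> ab by auto
        have vy: "norm (y (s - 1) - v s) \<le> \<eta>" if s: "s \<in> {a..c}" for s
        proof -
          have "norm ((y (s - 1) - x (s - 1)) - (v s - x (s - 1))) \<le> \<eta> / 3 + 2 * \<eta> / 3"
            by (rule order_trans[OF norm_triangle_ineq4 add_mono[OF near[OF past[OF s]] v[OF s]]])
          then show ?thesis by simp
        qed
        have vb: "norm (v s) \<le> real j + 1" if s: "s \<in> {a..c}" for s
        proof -
          have "norm (v s) \<le> norm (x (s - 1)) + norm (v s - x (s - 1))"
            by (rule norm_triangle_sub)
          also have "\<dots> \<le> real j + 2 * \<eta> / 3"
            using xb past[OF s] v[OF s] by (intro add_mono) auto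
          finally show ?thesis using \<eta>(2) by simp
        qed
        have ball_y: "norm (y s, y (s - 1)) \<le> real J" if "s \<in> {a..\<tau>}" for s
          unfolding J_def using that yb[of s] yb[of "s - 1"] by (intro norm_Pair_le_ball) auto
        have ball_v: "norm (y s, v s) \<le> real J" if "s \<in> {a..c}" for s
          unfolding J_def using that yb[of s] vb[of s] c by (intro norm_Pair_le_ball) auto
        have int_y: "set_integrable lebesgue {a'..b'} (\<lambda>s. g s (y s, y (s - 1)))"
          if "g \<in> LC 1" "a \<le> a'" "b' \<le> \<tau>" for g :: "'n delay_rhs" and a' b'
          using set_integrable_subset[OF set_integrable_delay_self[OF that(1) yc order_refl], of "{a'..b'}"] that by auto
        have int_v: "set_integrable lebesgue {a..c} (\<lambda>s. g s (y s, v s))"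
          if g: "g \<in> LC 1" for g :: "'n delay_rhs"
        proof (rule set_integrable_rhs[OF g])
          have "continuous_on {a..c} y"
            using c by (intro continuous_on_subset[OF yc]) auto
          then have "(\<lambda>s. indicator {a..c} s *\<^sub>R y s) \<in> borel_measurable borel"
            by (intro borel_measurable_continuous_on_indicator) auto
          moreover have "(\<lambda>s. indicator {a..c} s *\<^sub>R v s) \<in> borel_measurable borel"
            unfolding v_def by (intro borel_measurable_scaleR borel_measurable_ceiling_step) simp
          ultimately have "(\<lambda>s. indicator {a..c} s *\<^sub>R (y s, v s)) \<in> borel_measurable borel"
            unfolding scaleR_Pair by (rule borel_measurable_Pair)
          then show "set_borel_measurable lebesgue {a..c} (\<lambda>s. (y s, v s))"
            unfolding set_borel_measurable_def by (simp add: measurable_completion)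
          show "norm (y s, v s) \<le> real J" if "s \<in> {a..c}" for s
            by (rule ball_v[OF that])
        qed
        have rest: "norm (LINT s:{c..\<tau>}|lebesgue. F s (y s, y (s - 1))) \<le> \<epsilon> / 2"
        proof -
          have "ennreal (norm (LINT s:{c..\<tau>}|lebesgue. fs n s (y s, y (s - 1))))
              \<le> (\<integral>\<^sup>+s\<in>{c..\<tau>}. m_bound (fs n) J s \<partial>lebesgue)"
            by (rule norm_integral_le_m_bound) (use int_y[OF fs1] c ball_y in auto)
          also have "\<dots> \<le> (SUP g \<in> E. \<integral>\<^sup>+s\<in>{c..\<tau>}. m_bound g J s \<partial>lebesgue)"
            by (rule SUP_upper[OF fs])
          also have "\<dots> < ennreal (\<epsilon> / 4)"
            using c \<tau> ab h h0_def by (intro \<delta>2(2)) (auto simp: R_def)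
          finally have "norm (LINT s:{c..\<tau>}|lebesgue. fs n s (y s, y (s - 1))) < \<epsilon> / 4"
            by (simp add: ennreal_less_iff)
          moreover have "norm (LINT s:{c..\<tau>}|lebesgue. f s (y s, y (s - 1))) \<le> (LINT s:{c..\<tau>}|lebesgue. m s)"
          proof (rule norm_set_integral_le[OF _ ml(1)])
            show "set_integrable lebesgue {c..\<tau>} (\<lambda>s. f s (y s, y (s - 1)))"
              using int_y[OF f] c by auto
            show "AE s in lebesgue. s \<in> {c..\<tau>} \<longrightarrow> norm (f s (y s, y (s - 1))) \<le> m s"
              using ae_m by eventually_elim (use ball_y c in auto)
          qed
          moreover have "(LINT s:{c..\<tau>}|lebesgue. m s) < \<epsilon> / 4"
            using c \<tau> ab h h0_def by (intro \<rho>m(2)) auto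
          moreover have "(LINT s:{c..\<tau>}|lebesgue. F s (y s, y (s - 1))) =
              (LINT s:{c..\<tau>}|lebesgue. fs n s (y s, y (s - 1))) - (LINT s:{c..\<tau>}|lebesgue. f s (y s, y (s - 1)))"
            unfolding F_def fun_diff_def using c by (intro set_integral_diff(2) int_y fs1 f) auto
          ultimately show ?thesis
            using norm_triangle_ineq4[of "LINT s:{c..\<tau>}|lebesgue. fs n s (y s, y (s - 1))"
                "LINT s:{c..\<tau>}|lebesgue. f s (y s, y (s - 1))"] by simp
        qed
        have step: "norm (LINT s:{a..c}|lebesgue. F s (y s, v s)) \<le> \<epsilon> / 4"
        proof -
          have "norm (LINT s:{a..a + real k * h}|lebesgue. F s (y s, v s)) \<le> real k * (\<epsilon> / (4 * real N))"
          proof (rule solution_grid_estimate[OF _ h(1) F])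
            show "set_integrable lebesgue {a..a + real k * h} (\<lambda>s. F s (y s, v s))"
              using int_v[OF F] by (simp add: c_def q_def)
            show "v s = u i" if "a + real i * h < s" "s \<le> a + real (Suc i) * h" for i s
              unfolding v_def by (simp only: grid_cell[OF h(1) that])
            show "continuous_on {a..a + real k * h} y"
              using c by (intro continuous_on_subset[OF yc]) (auto simp: c_def q_def)
            fix i assume "i < k"
            then have i: "i < N" "q (Suc i) \<le> \<tau>" "a \<le> q i" "q i \<le> q (Suc i)"
              using k q_mono[of "Suc i" k] q_mono[of i "Suc i"] q_ab by auto
            \<comment> \<open>The moduli depend on the interval, so membership is established on
              each cell anew instead of being inherited from \<open>{a..b}\<close>.\<close>
            have "(\<lambda>t. y (min t (q (Suc i)))) \<in> K_set (m_bounds_moduli E) (q i) (q (Suc i)) J"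
            proof (rule \<rho>(2)[OF fs])
              show "solves_on (fs n) (q i) (q (Suc i)) y"
                using i by (intro solves_on_subinterval[OF fs1 y]) auto
              show "\<forall>s \<in> {q i - 1..q (Suc i)}. norm (y s) \<le> real j + 1"
                using yb i by auto
            qed (use i ab \<tau> in auto)
            from seminorm_ThetaD_upper[OF F this, of "u i"]
            have "norm (LINT s:{q i..q (Suc i)}|lebesgue. F s (y (min s (q (Suc i))), u i)) \<le> \<epsilon> / (4 * real N)"
              using elim i(1) by (force simp: F_def)
            also have "(LINT s:{q i..q (Suc i)}|lebesgue. F s (y (min s (q (Suc i))), u i)) =
                (LINT s:{q i..q (Suc i)}|lebesgue. F s (y s, u i))"
              by (intro set_lebesgue_integral_cong) (auto simp: min_def)
            finally show "norm (LINT s:{a + real i * h..a + real (Suc i) * h}|lebesgue. F s (y s, u i)) \<le> \<epsilon> / (4 * real N)"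
              by (simp only: q_def)
          qed
          also have "\<dots> \<le> real N * (\<epsilon> / (4 * real N))"
            using k(1) \<open>0 < \<epsilon>\<close> by (intro mult_right_mono) auto
          also have "\<dots> = \<epsilon> / 4"
            using \<open>0 < N\<close> by simp
          finally show ?thesis by (simp add: c_def q_def)
        qed
        have frozen: "norm (LINT s:{a..c}|lebesgue. F s (y s, y (s - 1)) - F s (y s, v s)) \<le> \<epsilon> / 4"
        proof -
          define A where "A g = (LINT s:{a..c}|lebesgue. g s (y s, y (s - 1)) - g s (y s, v s))" for g :: "'n delay_rhs"
          have int: "set_integrable lebesgue {a..c} (\<lambda>s. g s (y s, y (s - 1)) - g s (y s, v s))"
            if "g \<in> LC 1" for g :: "'n delay_rhs"
            using c by (intro set_integral_diff(1) int_y int_v that) auto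
          have "norm (A (fs n)) \<le> \<eta> * C"
            unfolding A_def
          proof (rule l2_bound_integral[OF int[OF fs1] _ vy \<eta>(1) _ C(1)])
            show "norm (y s, y (s - 1)) \<le> real J \<and> norm (y s, v s) \<le> real J" if "s \<in> {a..c}" for s
              using that ball_y ball_v c by auto
            have "(\<integral>\<^sup>+s\<in>{a..c}. l2_bound (fs n) J s \<partial>lebesgue) \<le> (\<integral>\<^sup>+s\<in>{-R..R}. l2_bound (fs n) J s \<partial>lebesgue)"
              using ab c \<tau> by (intro set_nn_integral_mono_set) (auto simp: R_def)
            also note C(2)[OF fs]
            finally show "(\<integral>\<^sup>+s\<in>{a..c}. l2_bound (fs n) J s \<partial>lebesgue) \<le> ennreal C" .
          qed
          moreover have "norm (A f) \<le> \<eta> * (LINT s:{a..c}|lebesgue. l s)"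
            unfolding A_def
          proof (rule rhs_integral_lipschitz[OF int[OF f] ml(2) ml(4) ae_l _ vy])
            show "norm (y s, y (s - 1)) \<le> real J \<and> norm (y s, v s) \<le> real J" if "s \<in> {a..c}" for s
              using that ball_y ball_v c by auto
          qed
          moreover have "(LINT s:{a..c}|lebesgue. l s) \<le> L"
          proof -
            have "0 \<le> (LINT s:{c..b}|lebesgue. l s)"
              using ml(4) by (auto simp: set_lebesgue_integral_def intro!: integral_nonneg)
            then show ?thesis
              using set_integral_combine[OF ml(2), of a c b] c \<tau> by (simp add: L_def)
          qed
          then have "\<eta> * (LINT s:{a..c}|lebesgue. l s) \<le> \<eta> * L"
            using \<eta>(1) by (intro mult_left_mono) auto
          moreover have "(LINT s:{a..c}|lebesgue. F s (y s, y (s - 1)) - F s (y s, v s)) = A (fs n) - A f"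
          proof -
            have "(LINT s:{a..c}|lebesgue. F s (y s, y (s - 1)) - F s (y s, v s)) =
                (LINT s:{a..c}|lebesgue. (fs n s (y s, y (s - 1)) - fs n s (y s, v s)) - (f s (y s, y (s - 1)) - f s (y s, v s)))"
              unfolding F_def fun_diff_def by (simp add: algebra_simps)
            also have "\<dots> = A (fs n) - A f"
              unfolding A_def by (intro set_integral_diff(2) int fs1 f)
            finally show ?thesis .
          qed
          ultimately show ?thesis
            using norm_triangle_ineq4[of "A (fs n)" "A f"] \<eta>CL by simp
        qed
        have "(LINT s:{a..c}|lebesgue. F s (y s, y (s - 1)) - F s (y s, v s)) =
            (LINT s:{a..c}|lebesgue. F s (y s, y (s - 1))) - (LINT s:{a..c}|lebesgue. F s (y s, v s))"
          using c by (intro set_integral_diff(2) int_y int_v F) auto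
        then have "norm (LINT s:{a..c}|lebesgue. F s (y s, y (s - 1))) \<le> \<epsilon> / 4 + \<epsilon> / 4"
          using frozen step norm_triangle_sub[of "LINT s:{a..c}|lebesgue. F s (y s, y (s - 1))" "LINT s:{a..c}|lebesgue. F s (y s, v s)"]
          by simp
        moreover have "(LINT s:{a..\<tau>}|lebesgue. F s (y s, y (s - 1))) =
            (LINT s:{a..c}|lebesgue. F s (y s, y (s - 1))) + (LINT s:{c..\<tau>}|lebesgue. F s (y s, y (s - 1)))"
          using c by (intro set_integral_combine int_y F) auto
        ultimately show "norm (LINT s:{a..\<tau>}|lebesgue. (fs n - f) s (y s, y (s - 1))) \<le> \<epsilon>"
          using rest norm_triangle_ineq[of "LINT s:{a..c}|lebesgue. F s (y s, y (s - 1))" "LINT s:{c..\<tau>}|lebesgue. F s (y s, y (s - 1))"]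
          unfolding F_def by simp
      qed
    qed
    then show ?thesis
      using \<eta>(1) by (intro exI[of _ "\<eta> / 3"]) simp
  qed
  show "\<exists>\<rho>>0. \<forall>a b x \<epsilon>. a \<in> \<rat> \<and> b \<in> \<rat> \<and> 0 \<le> a \<and> a \<le> b \<and> b \<le> r \<and>
     b - a < \<rho> \<and> 0 < \<epsilon> \<and> continuous_on {a-1..a} x \<and> (\<forall>s \<in> {a-1..a}. norm (x s) \<le> real j) \<longrightarrow>
     (\<exists>\<delta>>0. \<forall>\<^sub>F n in sequentially. \<forall>\<tau> y. a \<le> \<tau> \<and> \<tau> \<le> b \<and> solves_on (fs n) a \<tau> y \<and>
        (\<forall>s \<in> {a-1..\<tau>}. norm (y s) \<le> real j + 1) \<and> (\<forall>s \<in> {a-1..a}. norm (y s - x s) \<le> \<delta>) \<longrightarrow>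
        norm (LINT s:{a..\<tau>}|lebesgue. (fs n - f) s (y s, y (s - 1))) \<le> \<epsilon>)"
  proof (rule exI[of _ "min \<rho> 1"], intro conjI[of "0 < _"] allI impI)
    show "0 < min \<rho> 1"
      using \<rho>(1) by simp
  qed (elim conjE, rule main)
qed

subsection \<open>Continuous dependence\<close>

text \<open>At the first time \<sigma> with \<open>\<epsilon> \<le> g \<sigma>\<close> the
  intermediate value theorem forces \<open>g \<sigma> = \<epsilon>\<close>. The weak inequality thus
  holds up to and including \<sigma>, and \<open>improve\<close> makes it strict, a
  contradiction.\<close>

lemma stays_below_until:
  fixes g :: "real \<Rightarrow> real"
  assumes g: "continuous_on {a..t} g" and "g a < \<epsilon>"
    and improve: "\<And>\<sigma>. \<sigma> \<in> {a..t} \<Longrightarrow> (\<And>s. s \<in> {a..\<sigma>} \<Longrightarrow> g s \<le> \<epsilon>) \<Longrightarrow> g \<sigma> < \<epsilon>"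
    and s: "s \<in> {a..t}"
  shows "g s < \<epsilon>"
proof (rule ccontr)
  assume "\<not> g s < \<epsilon>"
  define A where "A = {s \<in> {a..t}. \<epsilon> \<le> g s}"
  have "s \<in> A"
    using s \<open>\<not> g s < \<epsilon>\<close> by (simp add: A_def)
  have "closed A"
    unfolding A_def by (intro continuous_on_closed_Collect_le g continuous_intros)
  moreover have "A \<subseteq> {a..t}"
    by (auto simp: A_def)
  ultimately have "compact A"
    by (meson bounded_closed_interval bounded_subset compact_eq_bounded_closed)
  then obtain \<sigma> where \<sigma>: "\<sigma> \<in> A" "\<And>s. s \<in> A \<Longrightarrow> \<sigma> \<le> s"
    using \<open>s \<in> A\<close> compact_attains_inf[of A] by blast
  then have mem: "\<sigma> \<in> {a..t}" "\<epsilon> \<le> g \<sigma>"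
    by (auto simp: A_def)
  have "continuous_on {a..\<sigma>} g"
    using mem by (intro continuous_on_subset[OF g]) auto
  then obtain s' where s': "a \<le> s'" "s' \<le> \<sigma>" "g s' = \<epsilon>"
    using IVT'[of g a \<epsilon> \<sigma>] mem \<open>g a < \<epsilon>\<close> by auto
  then have "s' \<in> A"
    using mem by (auto simp: A_def)
  then have "s' = \<sigma>"
    using \<sigma>(2)[of s'] s' by simp
  then have "g \<sigma> = \<epsilon>"
    using s' by simp
  have "g s \<le> \<epsilon>" if "s \<in> {a..\<sigma>}" for s
  proof (cases "s = \<sigma>")
    case False
    then have "s \<notin> A" using \<sigma>(2)[of s] that by auto
    then show ?thesis using that mem by (auto simp: A_def)
  qed (simp add: \<open>g \<sigma> = \<epsilon>\<close>)
  from improve[OF mem(1) this] mem(2) show False by simp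
qed

text \<open>The step length depends on \<open>T\<close> and on a bound of the limit solution, not on
  \<open>a\<close>, \<open>b\<close> or the accuracy, so the step can be iterated finitely
  often.\<close>

lemma continuous_dependence_step:
  fixes f :: "('n::finite) delay_rhs"
  assumes f: "f \<in> LC 1" and fs: "\<And>n. fs n \<in> LC 1"
    and \<phi>: "continuous_on {-1..0} \<phi>" and \<phi>s: "\<And>n. continuous_on {-1..0} (\<phi>s n)"
    and conv: "converges_along_solutions fs f"
    and T: "0 \<le> T" "ereal T < sol_end f \<phi>"
  shows "\<exists>\<rho>>0. \<forall>a b. a \<in> \<rat> \<and> b \<in> \<rat> \<and> 0 \<le> a \<and> a \<le> b \<and> b \<le> T \<and> b - a < \<rho> \<and>
    (\<forall>\<epsilon>>0. \<forall>\<^sub>F n in sequentially. ereal a < sol_end (fs n) (\<phi>s n) \<and>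
        (\<forall>s \<in> {-1..a}. norm (sol (fs n) (\<phi>s n) s - sol f \<phi> s) < \<epsilon>)) \<longrightarrow>
    (\<forall>\<epsilon>>0. \<forall>\<^sub>F n in sequentially. ereal b < sol_end (fs n) (\<phi>s n) \<and>
        (\<forall>s \<in> {-1..b}. norm (sol (fs n) (\<phi>s n) s - sol f \<phi> s) < \<epsilon>))"
proof -
  define x where "x = sol f \<phi>"
  have x: "solves_on f 0 T x"
    unfolding x_def by (rule solves_on_sol[OF f \<phi> T])
  have xc: "continuous_on {-1..T} x"
    using solves_on_continuous[OF x] by simp
  have "bounded (x ` {-1..T})"
    using xc by (simp add: compact_imp_bounded compact_continuous_image)
  then obtain c where "\<And>s. s \<in> {-1..T} \<Longrightarrow> norm (x s) \<le> c"
    unfolding bounded_iff by blast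
  moreover obtain j :: nat where "c \<le> real j"
    using real_arch_simple by blast
  ultimately have j: "norm (x s) \<le> real j" if "s \<in> {-1..T}" for s
    using that by (meson order_trans)
  obtain \<rho>1 where \<rho>1: "\<rho>1 > 0" "\<forall>a b x \<epsilon>. a \<in> \<rat> \<and> b \<in> \<rat> \<and> 0 \<le> a \<and> a \<le> b \<and> b \<le> T \<and>
     b - a < \<rho>1 \<and> 0 < \<epsilon> \<and> continuous_on {a-1..a} x \<and> (\<forall>s \<in> {a-1..a}. norm (x s) \<le> real j) \<longrightarrow>
     (\<exists>\<delta>>0. \<forall>\<^sub>F n in sequentially. \<forall>\<tau> y. a \<le> \<tau> \<and> \<tau> \<le> b \<and> solves_on (fs n) a \<tau> y \<and>
        (\<forall>s \<in> {a-1..\<tau>}. norm (y s) \<le> real j + 1) \<and> (\<forall>s \<in> {a-1..a}. norm (y s - x s) \<le> \<delta>) \<longrightarrow>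
        norm (LINT s:{a..\<tau>}|lebesgue. (fs n - f) s (y s, y (s - 1))) \<le> \<epsilon>)"
    using conv unfolding converges_along_solutions_def by blast
  obtain \<rho>2 where \<rho>2: "\<rho>2 > 0" "\<forall>a b e x y. 0 \<le> a \<and> a \<le> b \<and> b \<le> T \<and> b - a < \<rho>2 \<and>
      continuous_on {a-1..b} x \<and> continuous_on {a-1..b} y \<and>
      (\<forall>s \<in> {a-1..b}. norm (x s) \<le> real j + 1 \<and> norm (y s) \<le> real j + 1) \<and>
      (\<forall>s \<in> {a-1..a}. norm (y s - x s) \<le> e) \<and>
      (\<forall>t \<in> {a..b}. norm (y t - x t) \<le>
         e + norm (LINT s:{a..t}|lebesgue. f s (y s, y (s - 1)) - f s (x s, x (s - 1)))) \<longrightarrow>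
      (\<forall>s \<in> {a-1..b}. norm (y s - x s) \<le> 2 * e)"
    using gronwall_step[OF f, of T "real j + 1"] by blast
  have main: "\<forall>\<^sub>F n in sequentially. ereal b < sol_end (fs n) (\<phi>s n) \<and>
        (\<forall>s \<in> {-1..b}. norm (sol (fs n) (\<phi>s n) s - x s) < \<epsilon>)"
    if rat: "a \<in> \<rat>" "b \<in> \<rat>" and ab: "0 \<le> a" "a \<le> b" "b \<le> T" and len: "b - a < min \<rho>1 \<rho>2" and "0 < \<epsilon>"
      and IH: "\<forall>\<epsilon>>0. \<forall>\<^sub>F n in sequentially. ereal a < sol_end (fs n) (\<phi>s n) \<and>
        (\<forall>s \<in> {-1..a}. norm (sol (fs n) (\<phi>s n) s - x s) < \<epsilon>)" for a b \<epsilon>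
  proof -
    \<comment> \<open>Within \<open>1\<close> of \<open>x\<close> the solution \<open>y\<close>
      stays below \<open>real j + 1\<close>, the radius for which the two step lengths were
      chosen.\<close>
    define \<epsilon>' where "\<epsilon>' = min \<epsilon> 1"
    have \<epsilon>': "0 < \<epsilon>'" "\<epsilon>' \<le> 1" "\<epsilon>' \<le> \<epsilon>"
      using \<open>0 < \<epsilon>\<close> by (auto simp: \<epsilon>'_def)
    have "continuous_on {a-1..a} x"
      using ab by (intro continuous_on_subset[OF xc]) auto
    then have "\<exists>\<delta>>0. \<forall>\<^sub>F n in sequentially. \<forall>\<tau> y. a \<le> \<tau> \<and> \<tau> \<le> b \<and> solves_on (fs n) a \<tau> y \<and>
        (\<forall>s \<in> {a-1..\<tau>}. norm (y s) \<le> real j + 1) \<and> (\<forall>s \<in> {a-1..a}. norm (y s - x s) \<le> \<delta>) \<longrightarrow>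
        norm (LINT s:{a..\<tau>}|lebesgue. (fs n - f) s (y s, y (s - 1))) \<le> \<epsilon>' / 8"
      using rat ab len \<epsilon>' j
      by (intro \<rho>1(2)[THEN spec[of _ a], THEN spec[of _ b], THEN spec[of _ x], THEN spec[of _ "\<epsilon>' / 8"], THEN mp]) auto
    then obtain \<delta> where \<delta>: "\<delta> > 0" "\<forall>\<^sub>F n in sequentially. \<forall>\<tau> y. a \<le> \<tau> \<and> \<tau> \<le> b \<and> solves_on (fs n) a \<tau> y \<and>
        (\<forall>s \<in> {a-1..\<tau>}. norm (y s) \<le> real j + 1) \<and> (\<forall>s \<in> {a-1..a}. norm (y s - x s) \<le> \<delta>) \<longrightarrow>
        norm (LINT s:{a..\<tau>}|lebesgue. (fs n - f) s (y s, y (s - 1))) \<le> \<epsilon>' / 8"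
      by blast
    have "0 < min \<delta> (\<epsilon>' / 8)"
      using \<delta>(1) \<epsilon>'(1) by simp
    with IH have "\<forall>\<^sub>F n in sequentially. ereal a < sol_end (fs n) (\<phi>s n) \<and>
        (\<forall>s \<in> {-1..a}. norm (sol (fs n) (\<phi>s n) s - x s) < min \<delta> (\<epsilon>' / 8))"
      by blast
    with \<delta>(2) show ?thesis
    proof eventually_elim
      case (elim n)
      define y where "y = sol (fs n) (\<phi>s n)"
      define e where "e = sol_end (fs n) (\<phi>s n)"
      have a_e: "ereal a < e"
        using elim by (simp add: e_def)
      have near: "norm (y s - x s) < min \<delta> (\<epsilon>' / 8)" if "s \<in> {-1..a}" for s
        using elim that by (simp add: y_def)
      have near': "norm (y s - x s) < \<epsilon>' / 8" if "s \<in> {-1..a}" for s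
        using near[OF that] by simp
      have near_\<epsilon>: "norm (y s - x s) < \<epsilon>'" if "s \<in> {-1..a}" for s
        using near'[OF that] \<epsilon>'(1) by linarith
      have small: "norm (LINT s:{a..\<tau>}|lebesgue. (fs n - f) s (y s, y (s - 1))) \<le> \<epsilon>' / 8"
        if "a \<le> \<tau>" "\<tau> \<le> b" "solves_on (fs n) a \<tau> y" "\<forall>s \<in> {a-1..\<tau>}. norm (y s) \<le> real j + 1" for \<tau>
      proof -
        have "\<forall>s \<in> {a-1..a}. norm (y s - x s) \<le> \<delta>"
          using near ab by (auto intro: less_imp_le)
        then show ?thesis
          using elim that by blast
      qed
      have bound: "norm (y s) \<le> real j + 1" if "s \<in> {-1..T}" "norm (y s - x s) \<le> \<epsilon>'" for s
        using norm_triangle_sub[of "y s" "x s"] j[OF that(1)] that(2) \<epsilon>'(2) by linarith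
      have improve: "norm (y \<tau> - x \<tau>) < \<epsilon>'"
        if \<tau>: "a \<le> \<tau>" "\<tau> \<le> b" "ereal \<tau> < e" and le: "\<And>s. s \<in> {a..\<tau>} \<Longrightarrow> norm (y s - x s) \<le> \<epsilon>'" for \<tau>
      proof -
        have y: "solves_on (fs n) a \<tau> y"
          using \<tau> ab unfolding y_def e_def
          by (intro solves_on_subinterval[OF fs solves_on_sol[OF fs \<phi>s, of \<tau>]]) auto
        have x': "solves_on f a \<tau> x"
          using \<tau> ab by (intro solves_on_subinterval[OF f x]) auto
        have le': "norm (y s - x s) \<le> \<epsilon>'" if "s \<in> {a-1..\<tau>}" for s
        proof (cases "s \<le> a")
          case True
          then show ?thesis using that ab by (intro less_imp_le near_\<epsilon>) simp
        next
          case False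
          then show ?thesis using that by (intro le) simp
        qed
        have yb: "norm (y s) \<le> real j + 1" if "s \<in> {a-1..\<tau>}" for s
          using that \<tau> ab by (intro bound le') auto
        note yc = solves_on_continuous[OF y] and xc' = solves_on_continuous[OF x']
        \<comment> \<open>\<open>\<epsilon>' / 8\<close> comes from the value at \<open>a\<close>
          and \<open>\<epsilon>' / 8\<close> from \<open>fs n - f\<close> along \<open>y\<close>;
          \<open>gronwall_step\<close> doubles their sum to \<open>\<epsilon>' / 2\<close>, strictly
          below the threshold assumed.\<close>
        have gap: "norm (y t - x t) \<le> \<epsilon>' / 4 + norm (LINT s:{a..t}|lebesgue. f s (y s, y (s - 1)) - f s (x s, x (s - 1)))"
          if t: "t \<in> {a..\<tau>}" for t
        proof -
          have yt: "solves_on (fs n) a t y" and xt: "solves_on f a t x"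
            using t solves_on_subinterval[OF fs y] solves_on_subinterval[OF f x'] by auto
          define A B C where "A = (LINT s:{a..t}|lebesgue. fs n s (y s, y (s - 1)))"
            and "B = (LINT s:{a..t}|lebesgue. f s (y s, y (s - 1)))"
            and "C = (LINT s:{a..t}|lebesgue. f s (x s, x (s - 1)))"
          have int: "set_integrable lebesgue {a..t} (\<lambda>s. fs n s (y s, y (s - 1)))"
            "set_integrable lebesgue {a..t} (\<lambda>s. f s (y s, y (s - 1)))"
            "set_integrable lebesgue {a..t} (\<lambda>s. f s (x s, x (s - 1)))"
            by (intro set_integrable_delay_self[OF _ _ order_refl] fs f
                solves_on_continuous[OF yt] solves_on_continuous[OF xt])+
          have "norm (LINT s:{a..t}|lebesgue. (fs n - f) s (y s, y (s - 1))) \<le> \<epsilon>' / 8"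
            using t \<tau> yt yb by (intro small) auto
          moreover have "(LINT s:{a..t}|lebesgue. (fs n - f) s (y s, y (s - 1))) = A - B"
            unfolding fun_diff_def A_def B_def by (rule set_integral_diff(2)[OF int(1,2)])
          moreover have "(LINT s:{a..t}|lebesgue. f s (y s, y (s - 1)) - f s (x s, x (s - 1))) = B - C"
            unfolding B_def C_def by (rule set_integral_diff(2)[OF int(2,3)])
          moreover have "y t - x t = (y a - x a) + ((A - B) + (B - C))"
          proof -
            have "y t = y a + A" "x t = x a + C"
              unfolding A_def C_def using t by (auto intro!: solves_on_eq[OF yt] solves_on_eq[OF xt])
            then show ?thesis by simp
          qed
          then have "norm (y t - x t) \<le> norm (y a - x a) + (norm (A - B) + norm (B - C))"
            by (metis norm_triangle_le add_left_mono norm_triangle_ineq)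
          moreover have "norm (y a - x a) \<le> \<epsilon>' / 8"
            using ab by (intro less_imp_le near') simp
          ultimately show ?thesis by simp
        qed
        have "\<forall>s \<in> {a-1..\<tau>}. norm (y s - x s) \<le> 2 * (\<epsilon>' / 4)"
        proof (rule \<rho>2(2)[THEN spec[of _ a], THEN spec[of _ \<tau>], THEN spec[of _ "\<epsilon>' / 4"], THEN spec[of _ x],
                THEN spec[of _ y], THEN mp], intro conjI ballI)
          show "0 \<le> a" "a \<le> \<tau>" "\<tau> \<le> T" "\<tau> - a < \<rho>2"
            using \<tau> ab len by auto
          show "norm (x s) \<le> real j + 1" if "s \<in> {a-1..\<tau>}" for s
            using j[of s] that ab \<tau> by auto
          show "norm (y s - x s) \<le> \<epsilon>' / 4" if "s \<in> {a-1..a}" for s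
          proof -
            have "s \<in> {-1..a}"
              using that ab by auto
            from near'[OF this] show ?thesis
              using \<epsilon>'(1) by simp
          qed
        qed (rule xc' yc yb gap; assumption)+
        then have "norm (y \<tau> - x \<tau>) \<le> \<epsilon>' / 2"
          using \<tau> by simp
        with \<epsilon>'(1) show ?thesis by simp
      qed
      \<comment> \<open>Proved up to the end \<open>e\<close> of \<open>y\<close>, which at this
        point may still precede \<open>b\<close>.\<close>
      have close: "norm (y t - x t) < \<epsilon>'" if t: "-1 \<le> t" "t \<le> b" "ereal t < e" for t
      proof (cases "t \<le> a")
        case True
        then show ?thesis using t by (intro near_\<epsilon>) simp
      next
        case False
        have yt: "continuous_on {0-1..t} y"
          unfolding y_def using False ab t(3)
          by (intro solves_on_continuous[OF solves_on_sol[OF fs \<phi>s]]) (auto simp: e_def)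
        have cont: "continuous_on {a..t} (\<lambda>s. norm (y s - x s))"
          by (intro continuous_on_norm continuous_on_diff continuous_on_subset[OF yt] continuous_on_subset[OF xc])
            (use ab t in auto)
        show ?thesis
        proof (rule stays_below_until[OF cont])
          show "norm (y a - x a) < \<epsilon>'"
            using ab by (intro near_\<epsilon>) simp
          show "norm (y \<sigma> - x \<sigma>) < \<epsilon>'" if "\<sigma> \<in> {a..t}" "\<And>s. s \<in> {a..\<sigma>} \<Longrightarrow> norm (y s - x s) \<le> \<epsilon>'" for \<sigma>
          proof (rule improve[OF _ _ _ that(2)])
            show "ereal \<sigma> < e"
              using that(1) t(3) by (auto intro: order_le_less_trans[of _ "ereal t"])
          qed (use that t in auto)
        qed (use False in auto)
      qed
      \<comment> \<open>Otherwise closeness to \<open>x\<close> bounds \<open>y\<close> by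
        \<open>real j + 1\<close> on its whole domain, while a finite end forces larger
        values.\<close>
      have b_e: "ereal b < e"
      proof (rule ccontr)
        assume "\<not> ereal b < e"
        then have eb: "e \<le> ereal b" by simp
        then obtain t where t: "-1 \<le> t" "ereal t < e" "real j + 1 < norm (y t)"
          using sol_blow_up[OF fs[of n] \<phi>s[of n], of b "real j + 1"] by (auto simp: e_def y_def)
        have "t \<le> b"
          using less_le_trans[OF t(2) eb] by simp
        then have "norm (y t) \<le> real j + 1"
          using close[of t] t ab by (intro bound) auto
        with t(3) show False by simp
      qed
      have "norm (y s - x s) < \<epsilon>" if "s \<in> {-1..b}" for s
      proof -
        have "ereal s < e"
          using that b_e by (auto intro: order_le_less_trans[of _ "ereal b"])
        then show ?thesis
          using close[of s] that \<epsilon>'(3) by simp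
      qed
      with b_e show ?case
        by (simp add: y_def e_def)
    qed
  qed
  show ?thesis
  proof (rule exI[of _ "min \<rho>1 \<rho>2"], intro conjI[of "0 < _"] allI impI)
    show "0 < min \<rho>1 \<rho>2"
      using \<rho>1(1) \<rho>2(1) by simp
  qed (elim conjE, rule main[unfolded x_def])
qed

lemma continuous_dependence:
  fixes f :: "('n::finite) delay_rhs"
  assumes f: "f \<in> LC 1" and fs: "\<And>n. fs n \<in> LC 1"
    and \<phi>: "continuous_on {-1..0} \<phi>" and \<phi>s: "\<And>n. continuous_on {-1..0} (\<phi>s n)"
    and lim: "uniform_limit {-1..0} \<phi>s \<phi> sequentially"
    and conv: "converges_along_solutions fs f"
    and T: "ereal T < sol_end f \<phi>"
  shows "(\<forall>\<^sub>F n in sequentially. ereal T < sol_end (fs n) (\<phi>s n)) \<and>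
    uniform_limit {-1..T} (\<lambda>n. sol (fs n) (\<phi>s n)) (sol f \<phi>) sequentially"
proof -
  have "ereal (max T 0) < sol_end f \<phi>"
    using T sol_end_pos[OF f \<phi>] by (auto simp: max_def zero_ereal_def)
  then obtain T1 where T1: "ereal (max T 0) < ereal T1" "ereal T1 < sol_end f \<phi>"
    using ereal_dense2 by blast
  \<comment> \<open>A positive rational beyond \<open>T\<close> and before the end of the limit
    solution: equal subdivision of \<open>{0..S}\<close> then has rational nodes, also when
    \<open>T\<close> is negative or irrational.\<close>
  then obtain S where S: "S \<in> \<rat>" "max T 0 < S" "S < T1"
    using Rats_dense_in_real[of "max T 0" T1] by auto
  then have S': "0 < S" "T < S" "ereal S < sol_end f \<phi>"
    using T1(2) by (auto intro: order_less_trans[of _ "ereal T1"])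
  \<comment> \<open>All accuracies are carried together, because a given accuracy at the next node
    requires a finer one, depending on the topology, at the present node.\<close>
  define P where "P a \<longleftrightarrow> (\<forall>\<epsilon>>0. \<forall>\<^sub>F n in sequentially. ereal a < sol_end (fs n) (\<phi>s n) \<and>
        (\<forall>s \<in> {-1..a}. norm (sol (fs n) (\<phi>s n) s - sol f \<phi> s) < \<epsilon>))" for a
  have "\<exists>\<rho>>0. \<forall>a b. a \<in> \<rat> \<and> b \<in> \<rat> \<and> 0 \<le> a \<and> a \<le> b \<and> b \<le> S \<and> b - a < \<rho> \<and> P a \<longrightarrow> P b"
    unfolding P_def by (rule continuous_dependence_step[OF f fs \<phi> \<phi>s conv less_imp_le[OF S'(1)] S'(3)])
  then obtain \<rho> where \<rho>: "\<rho> > 0"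
    and step: "\<And>a b. a \<in> \<rat> \<Longrightarrow> b \<in> \<rat> \<Longrightarrow> 0 \<le> a \<Longrightarrow> a \<le> b \<Longrightarrow> b \<le> S \<Longrightarrow> b - a < \<rho> \<Longrightarrow> P a \<Longrightarrow> P b"
    by blast
  obtain N :: nat where N: "S < real N * \<rho>"
    using ex_less_of_nat_mult[OF \<rho>] by blast
  then have "0 < N"
    using S'(1) by (cases N) auto
  define h where "h = S / real N"
  have h: "0 < h" "h < \<rho>" "h \<in> \<rat>" "real N * h = S"
    using N \<open>0 < N\<close> S' S(1) by (auto simp: h_def divide_less_eq mult.commute)
  have "P (real k * h)" if "k \<le> N" for k
    using that
  proof (induction k)
    case 0
    have "\<forall>\<^sub>F n in sequentially. ereal 0 < sol_end (fs n) (\<phi>s n) \<and>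
        (\<forall>s \<in> {-1..0}. norm (sol (fs n) (\<phi>s n) s - sol f \<phi> s) < \<epsilon>)" if "0 < \<epsilon>" for \<epsilon>
      using uniform_limitD[OF lim that]
    proof eventually_elim
      case (elim n)
      then show ?case
        using sol_end_pos[OF fs \<phi>s] sol_initial[OF fs \<phi>s] sol_initial[OF f \<phi>]
        by (simp add: dist_norm zero_ereal_def)
    qed
    then show ?case
      by (simp add: P_def)
  next
    case (Suc k)
    have "real (Suc k) * h \<le> real N * h"
      using Suc h(1) by (intro mult_right_mono) auto
    then have le: "real (Suc k) * h \<le> S"
      by (simp only: h(4))
    show ?case
    proof (rule step[OF _ _ _ _ le])
      show "real k * h \<in> \<rat>" "real (Suc k) * h \<in> \<rat>"
        by (intro Rats_mult Rats_of_nat h(3))+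
      show "0 \<le> real k * h"
        using h(1) by simp
      show "real k * h \<le> real (Suc k) * h"
        using h(1) by (simp add: distrib_right)
      show "real (Suc k) * h - real k * h < \<rho>"
        using h(2) by (simp add: distrib_right)
      show "P (real k * h)"
        using Suc by simp
    qed
  qed
  from this[of N] have PS: "P S"
    using h(4) by simp
  have "\<forall>\<^sub>F n in sequentially. ereal T < sol_end (fs n) (\<phi>s n)"
    using PS[unfolded P_def, rule_format, OF zero_less_one]
    by eventually_elim (use S'(2) in \<open>auto intro: order_less_trans[of _ "ereal S"]\<close>)
  moreover have "uniform_limit {-1..T} (\<lambda>n. sol (fs n) (\<phi>s n)) (sol f \<phi>) sequentially"
  proof (rule uniform_limitI)
    fix \<epsilon> :: real assume "0 < \<epsilon>"
    show "\<forall>\<^sub>F n in sequentially. \<forall>s \<in> {-1..T}. dist (sol (fs n) (\<phi>s n) s) (sol f \<phi> s) < \<epsilon>"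
      using PS[unfolded P_def, rule_format, OF \<open>0 < \<epsilon>\<close>]
      by eventually_elim (use S'(2) in \<open>auto simp: dist_norm\<close>)
  qed
  ultimately show ?thesis by blast
qed

theorem theorem3p9:
  fixes p :: nat and E :: "('n::finite) delay_rhs set" and D :: "(real ^ 'n) set"
    and fs :: "nat \<Rightarrow> 'n delay_rhs" and f :: "'n delay_rhs"
    and \<phi>s :: "nat \<Rightarrow> real \<Rightarrow> real ^ 'n" and \<phi> :: "real \<Rightarrow> real ^ 'n"
  assumes "1 \<le> p"
    and "E \<subseteq> LC p"
    and "L1loc_equicontinuous_m_bounds E"
    and "countable D" and "closure D = UNIV"
    and "\<forall>n. fs n \<in> E"
    and "\<forall>n. continuous_on {-1..0} (\<phi>s n)" and "continuous_on {-1..0} \<phi>"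
    and "uniform_limit {-1..0} \<phi>s \<phi> sequentially"
  shows "(limitin (T_ThetaB p (m_bounds_moduli E)) fs f sequentially \<longrightarrow>
           (\<forall>T. -1 \<le> T \<and> ereal T < sol_end f \<phi> \<longrightarrow>
              (\<forall>\<^sub>F n in sequentially. ereal T < sol_end (fs n) (\<phi>s n)) \<and>
              uniform_limit {-1..T} (\<lambda>n. sol (fs n) (\<phi>s n)) (sol f \<phi>) sequentially)) \<and>
         (L1loc_bounded_l2_bounds E \<and>
          limitin (sigma_ThetaD (m_bounds_moduli E) D) fs f sequentially \<longrightarrow>
           (\<forall>T. -1 \<le> T \<and> ereal T < sol_end f \<phi> \<longrightarrow>
              (\<forall>\<^sub>F n in sequentially. ereal T < sol_end (fs n) (\<phi>s n)) \<and>
              uniform_limit {-1..T} (\<lambda>n. sol (fs n) (\<phi>s n)) (sol f \<phi>) sequentially))"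
proof -
  have E1: "E \<subseteq> LC 1"
    using assms(1,2) LC_subset_LC1 by blast
  have fs: "fs n \<in> E" "fs n \<in> LC 1" for n
    using assms(6) E1 by auto
  have \<phi>s: "continuous_on {-1..0} (\<phi>s n)" for n
    using assms(7) by blast
  \<comment> \<open>Both parts end in the same statement; they differ only in how
    \<open>converges_along_solutions\<close> and \<open>f \<in> LC 1\<close> are obtained.\<close>
  note dependence = continuous_dependence[OF _ fs(2) assms(8) \<phi>s assms(9)]
  show ?thesis
  proof (intro conjI[of "_ \<longrightarrow> _" "_ \<longrightarrow> _"] impI allI)
    fix T
    assume lim: "limitin (T_ThetaB p (m_bounds_moduli E)) fs f sequentially"
      and T: "-1 \<le> T \<and> ereal T < sol_end f \<phi>"
    have "f \<in> LC p"
      using limitin_seminorm_topology(1)[OF lim[unfolded T_ThetaB_def]] .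
    then have "f \<in> LC 1"
      using LC_subset_LC1[OF assms(1)] by blast
    from dependence[OF this T_ThetaB_converges_along_solutions[OF assms(1-3) fs(1) lim]] T
    show "(\<forall>\<^sub>F n in sequentially. ereal T < sol_end (fs n) (\<phi>s n)) \<and>
        uniform_limit {-1..T} (\<lambda>n. sol (fs n) (\<phi>s n)) (sol f \<phi>) sequentially"
      by blast
  next
    fix T
    assume lim: "L1loc_bounded_l2_bounds E \<and> limitin (sigma_ThetaD (m_bounds_moduli E) D) fs f sequentially"
      and T: "-1 \<le> T \<and> ereal T < sol_end f \<phi>"
    have "f \<in> LC 1"
      using limitin_seminorm_topology(1)[OF conjunct2[OF lim, unfolded sigma_ThetaD_def]] .
    from dependence[OF this sigma_ThetaD_converges_along_solutions[OF E1 assms(3) conjunct1[OF lim]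
          assms(5) fs(1) conjunct2[OF lim]]] T
    show "(\<forall>\<^sub>F n in sequentially. ereal T < sol_end (fs n) (\<phi>s n)) \<and>
        uniform_limit {-1..T} (\<lambda>n. sol (fs n) (\<phi>s n)) (sol f \<phi>) sequentially"
      by blast
  qed
qed

end
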